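(* Let $\mathscr{L}\subseteq\ell^\infty(\mathbb{Z})$ be the space of all real-valued limit-periodic potentials, with the $\ell^\infty(\mathbb{Z})$ topology. There is a dense set of $V\in\mathscr{L}$ for which the Lyapunov exponent $E\mapsto L(E)$, $E\in\mathbb{R}$, is discontinuous (i.e. is not a continuous function on $\mathbb{R}$).
   Context: A bounded $V:\mathbb{Z}\to\mathbb{R}$ is limit-periodic if it is the limit in $\ell^\infty(\mathbb{Z})$ of a sequence of periodic potentials $V^k:\mathbb{Z}\to\mathbb{R}$. Its hull is $\Omega_V=\overline{\{V(\cdot-m):m\in\mathbb{Z}\}}^{\ell^\infty(\mathbb{Z})}$; it is compact and carries the structure of a compact abelian group on which the shift is a uniquely ergodic translation, the unique invariant probability measure being the Haar measure $\mu$. For $W:\mathbb{Z}\to\mathbb{R}$ and $E\in\mathbb{R}$ set $$A_N(E,W)=\prod_{n=1}^{N}\begin{pmatrix}E-W(N-n)&-1\\1&0\end{pmatrix}$$ (factors left to right for $n=1,\dots,N$). The Lyapunov exponent of $V$ is $$L(E)=\lim_{N\to\infty}\frac1N\int_{\Omega_V}\log\|A_N(E,W)\|\,d\mu(W).$$ *)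

theory Defs
  imports "HOL-Probability.Probability"
begin

text \<open>Since \<^typ>\<open>int\<close> is discrete, \<^typ>\<open>int \<Rightarrow>\<^sub>C real\<close> consists of all bounded functions and its
  norm is the supremum norm, so it is the real space \<open>\<ell>\<^sup>\<infinity>(\<int>)\<close>.\<close>

type_synonym potential = "int \<Rightarrow>\<^sub>C real"

definition periodic :: "(int \<Rightarrow> real) \<Rightarrow> bool" where
  "periodic f \<longleftrightarrow> (\<exists>p>0. \<forall>n. f (n + p) = f n)"

text \<open>Periodic functions on the integers are bounded, so taking the approximants in
  \<^typ>\<open>potential\<close> is no restriction.\<close>

definition limit_periodic :: "potential \<Rightarrow> bool" where
  "limit_periodic V \<longleftrightarrow>
     (\<exists>Vk :: nat \<Rightarrow> potential. (\<forall>k. periodic (apply_bcontfun (Vk k))) \<and> Vk \<longlonglongrightarrow> V)"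

definition translate :: "int \<Rightarrow> potential \<Rightarrow> potential" where
  "translate m V = Bcontfun (\<lambda>n. V (n - m))"

lemma apply_translate [simp]: "apply_bcontfun (translate m V) n = V (n - m)"
proof -
  have "bounded (range (\<lambda>n. V (n - m)))"
    by (rule bounded_subset[OF bounded_apply_bcontfun[of V]]) auto
  then have "(\<lambda>n. V (n - m)) \<in> bcontfun"
    by (simp add: bcontfun_def)
  then show ?thesis
    by (simp add: translate_def Bcontfun_inverse)
qed

definition potential_hull :: "potential \<Rightarrow> potential set" where
  "potential_hull V = closure (range (\<lambda>m. translate m V))"

text \<open>For limit-periodic \<open>V\<close> the shift on the hull is uniquely ergodic, and its unique invariant
  Borel probability measure is the Haar measure of the hull. It is singled out here by that
  property; the definite description is meaningful only for uniquely ergodic hulls.\<close>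

definition hull_measure :: "potential \<Rightarrow> potential measure" where
  "hull_measure V =
     (THE \<mu>. sets \<mu> = sets (restrict_space borel (potential_hull V)) \<and> prob_space \<mu> \<and>
             distr \<mu> \<mu> (translate 1) = \<mu>)"

definition one_step_matrix :: "real \<Rightarrow> real \<Rightarrow> real^2^2" where
  "one_step_matrix E v = vector [vector [E - v, - 1], vector [1, 0]]"

definition transfer_matrix :: "nat \<Rightarrow> real \<Rightarrow> (int \<Rightarrow> real) \<Rightarrow> real^2^2" where
  "transfer_matrix N E W =
     foldr (\<lambda>n P. one_step_matrix E (W (int N - int n)) ** P) [1..<Suc N] (mat 1)"

text \<open>The norm on \<^typ>\<open>real^2^2\<close> in the library is the Frobenius norm, hence the explicit
  operator norm.\<close>

definition lyapunov_exponent :: "potential \<Rightarrow> real \<Rightarrow> real" where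
  "lyapunov_exponent V E =
     lim (\<lambda>N. 1 / real N *
       (\<integral>W. ln (onorm ((*v) (transfer_matrix N E (apply_bcontfun W)))) \<partial>hull_measure V))"

end

theory Submission
  imports Defs "HOL-Computational_Algebra.Polynomial"
begin

text \<open>
  Let \<open>V\<close> be \<open>p\<close>-periodic and \<open>E\<close> an energy in a gap, close to a band edge. A single-site impurity
  of a suitable small strength \<open>d\<close> creates a bound state of \<open>V\<close> at \<open>E\<close>. Placing such impurities
  periodically, one in every \<open>n\<close> periods, puts \<open>E\<close> into the spectrum, so that the Lyapunov exponent
  vanishes there, while at a nearby energy \<open>E'\<close> it changes only by \<open>O(1/n)\<close> and hence stays above
  a fixed \<open>c > 0\<close>; moreover the critical strength at \<open>E'\<close> is again small, uniformly in \<open>n\<close>.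
  Iterating gives a limit-periodic limit \<open>V\<close> and energies \<open>E\<^sub>k\<close> converging to some \<open>x\<close>. Upper
  semicontinuity yields \<open>L(x) \<ge> c\<close>. On the other hand \<open>L(E\<^sub>k) \<le> c/2\<close>: the transfer matrices at \<open>E\<^sub>k\<close>
  of the stage at which \<open>E\<^sub>k\<close> is elliptic are bounded, and the later changes are either sparse or tiny.
\<close>

section \<open>Operator norms of transfer matrices\<close>

text \<open>By upper semicontinuity the exponent can only fail to be continuous by being larger at
  \<open>x\<close> than near it, so low values must be produced at energies converging to
  \<open>x\<close>. The uniformity in n comes from an explicit formula. Let l and m = 1/l be the
  eigenvalues over one period with |l| > 1, put s = l - m, and let z be the lower left matrix entry.
  After n periods with one impurity d, the trace is asymptotic to (1 - d z / s) l^n and the lower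
  left entry to (z / s) l^n. The next critical strength is at most the modulus of their quotient,
  which tends to |s / z - d|. At E this limit is 0, because criticality means d = s / z; at E' near
  E it is small, and n may still be taken as large as desired. Only those E' must be avoided at
  which d is critical again, and they are roots of a nonzero polynomial. The initial strength sqrt
  (t^2 - 4) / z is small since the trace t is taken slightly above 2. As \<open>hull_measure\<close>
  is a definite description, nothing can be said about the exponent before existence and uniqueness
  of the invariant measure are proved.\<close>

lemma matrix_diff_ldistrib:
  fixes A :: "'a::ring_1 ^ 'n ^ 'm"
  shows "A ** (B - C) = A ** B - A ** C"
  by (simp add: vec_eq_iff matrix_matrix_mult_def sum_subtractf right_diff_distrib)

lemma matrix_diff_rdistrib:
  fixes C :: "'a::ring_1 ^ 'n ^ 'm"
  shows "(A - B) ** C = A ** C - B ** C"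
  by (simp add: vec_eq_iff matrix_matrix_mult_def sum_subtractf left_diff_distrib)

definition op_norm :: "real^2^2 \<Rightarrow> real" where
  "op_norm A = onorm ((*v) A)"

lemma norm_mult_le_op_norm: "norm (A *v x) \<le> op_norm A * norm x"
  unfolding op_norm_def by (rule onorm[OF matrix_vector_mul_bounded_linear])

lemma op_norm_nonneg [simp]: "0 \<le> op_norm A"
  unfolding op_norm_def by (rule onorm_pos_le[OF matrix_vector_mul_bounded_linear])

lemma op_norm_leI: "(\<And>x. norm (A *v x) \<le> b * norm x) \<Longrightarrow> op_norm A \<le> b"
  unfolding op_norm_def by (rule onorm_le)

lemma op_norm_mult: "op_norm (A ** B) \<le> op_norm A * op_norm B"
proof (rule op_norm_leI)
  fix x
  have "norm ((A ** B) *v x) = norm (A *v (B *v x))"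
    by (simp add: matrix_vector_mul_assoc)
  also have "\<dots> \<le> op_norm A * (op_norm B * norm x)"
    by (rule order_trans[OF norm_mult_le_op_norm]) (intro mult_left_mono norm_mult_le_op_norm op_norm_nonneg)
  finally show "norm ((A ** B) *v x) \<le> op_norm A * op_norm B * norm x" by simp
qed

lemma op_norm_add: "op_norm (A + B) \<le> op_norm A + op_norm B"
proof (rule op_norm_leI)
  fix x
  show "norm ((A + B) *v x) \<le> (op_norm A + op_norm B) * norm x"
    unfolding matrix_vector_mult_add_rdistrib distrib_right
    by (rule order_trans[OF norm_triangle_ineq add_mono[OF norm_mult_le_op_norm norm_mult_le_op_norm]])
qed

lemma op_norm_scaleR: "op_norm (c *\<^sub>R A) \<le> \<bar>c\<bar> * op_norm A"
proof (rule op_norm_leI)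
  fix x
  have "norm ((c *\<^sub>R A) *v x) = \<bar>c\<bar> * norm (A *v x)"
    by (simp add: scaleR_matrix_vector_assoc[symmetric])
  also have "\<dots> \<le> \<bar>c\<bar> * (op_norm A * norm x)"
    by (intro mult_left_mono norm_mult_le_op_norm) auto
  finally show "norm ((c *\<^sub>R A) *v x) \<le> \<bar>c\<bar> * op_norm A * norm x" by (simp add: mult.assoc)
qed

lemma op_norm_minus: "op_norm (- A) = op_norm A"
proof -
  have "op_norm (- A) \<le> op_norm A" for A using op_norm_scaleR[of "-1" A] by simp
  from this[of A] this[of "- A"] show ?thesis by simp
qed

lemma op_norm_diff: "op_norm (A - B) \<le> op_norm A + op_norm B"
  using op_norm_add[of A "- B"] by (simp add: op_norm_minus)

lemma op_norm_mat_1: "op_norm (mat 1) \<le> 1"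
  by (rule op_norm_leI) simp

text \<open>The determinant is the inner product of one column with the other rotated by a right
  angle, so Cauchy-Schwarz applies. This makes logarithms of norms of transfer matrices
  nonnegative.\<close>

lemma op_norm_ge_1_if_det_1:
  assumes "det A = 1"
  shows "1 \<le> op_norm A"
proof -
  define u v where "u = A *v axis 1 1" and "v = A *v axis 2 1"
  have nu: "norm u \<le> op_norm A" and nv: "norm v \<le> op_norm A"
    using norm_mult_le_op_norm[of A "axis 1 1"] norm_mult_le_op_norm[of A "axis 2 1"]
    by (simp_all add: u_def v_def norm_axis_1)
  have uc: "u $ i = A $ i $ 1" "v $ i = A $ i $ 2" for i
    by (simp_all add: u_def v_def matrix_vector_mult_basis column_def)
  define v' :: "real^2" where "v' = vector [v $ 2, - (v $ 1)]"
  have "norm v' = norm v"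
    by (simp add: v'_def norm_vec_def L2_set_def sum_2 add.commute)
  have "1 = inner u v'"
    using assms by (simp add: det_2 uc v'_def inner_vec_def sum_2 algebra_simps)
  also have "\<dots> \<le> norm u * norm v'"
    by (rule norm_cauchy_schwarz)
  also have "\<dots> \<le> op_norm A * op_norm A"
    unfolding \<open>norm v' = norm v\<close> by (intro mult_mono nu nv) auto
  finally have "1\<^sup>2 \<le> (op_norm A)\<^sup>2" by (simp add: power2_eq_square)
  then show ?thesis by (rule power2_le_imp_le) simp
qed

lemma one_step_matrix_nth:
  "one_step_matrix E v $ 1 $ 1 = E - v" "one_step_matrix E v $ 1 $ 2 = - 1"
  "one_step_matrix E v $ 2 $ 1 = 1" "one_step_matrix E v $ 2 $ 2 = 0"
  by (simp_all add: one_step_matrix_def)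

lemma op_norm_one_step_diff:
  "op_norm (one_step_matrix E v - one_step_matrix E' v') \<le> \<bar>(E - v) - (E' - v')\<bar>"
proof (rule op_norm_leI)
  fix x :: "real^2"
  have "(one_step_matrix E v - one_step_matrix E' v') *v x
      = (((E - v) - (E' - v')) * x $ 1) *\<^sub>R axis 1 1"
    by (simp add: vec_eq_iff forall_2 matrix_vector_mult_def sum_2 one_step_matrix_nth axis_def)
  then have "norm ((one_step_matrix E v - one_step_matrix E' v') *v x)
      = \<bar>(E - v) - (E' - v')\<bar> * \<bar>x $ 1\<bar>"
    by (simp add: norm_axis_1 abs_mult)
  also have "\<dots> \<le> \<bar>(E - v) - (E' - v')\<bar> * norm x"
    by (intro mult_left_mono component_le_norm_cart) auto
  finally show "norm ((one_step_matrix E v - one_step_matrix E' v') *v x)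
      \<le> \<bar>(E - v) - (E' - v')\<bar> * norm x" .
qed

lemma op_norm_one_step: "op_norm (one_step_matrix E v) \<le> 1 + \<bar>E - v\<bar>"
proof -
  have "op_norm (one_step_matrix 0 0) \<le> 1"
  proof (rule op_norm_leI)
    fix x :: "real^2"
    show "norm (one_step_matrix 0 0 *v x) \<le> 1 * norm x"
      by (simp add: norm_vec_def L2_set_def sum_2 matrix_vector_mult_def one_step_matrix_nth add.commute)
  qed
  moreover have "op_norm (one_step_matrix E v) \<le>
     op_norm (one_step_matrix E v - one_step_matrix 0 0) + op_norm (one_step_matrix 0 0)"
    using op_norm_add[of "one_step_matrix E v - one_step_matrix 0 0" "one_step_matrix 0 0"] by simp
  ultimately show ?thesis using op_norm_one_step_diff[of E v 0 0] by simp
qed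

lemma det_one_step [simp]: "det (one_step_matrix E v) = 1"
  by (simp add: det_2 one_step_matrix_nth)

section \<open>Growth and perturbation of transfer matrices\<close>

lemma transfer_matrix_0 [simp]: "transfer_matrix 0 E W = mat 1"
  by (simp add: transfer_matrix_def)

lemma transfer_matrix_Suc:
  "transfer_matrix (Suc N) E W = one_step_matrix E (W (int N)) ** transfer_matrix N E W"
proof -
  have *: "[1..<Suc (Suc N)] = 1 # map Suc [1..<Suc N]"
    by (subst upt_conv_Cons) (auto simp del: upt_Suc simp: map_Suc_upt)
  show ?thesis
    unfolding transfer_matrix_def * by (simp add: foldr_map comp_def del: upt_Suc)
qed

lemma transfer_matrix_cong:
  "(\<And>x. x < N \<Longrightarrow> W (int x) = W' (int x)) \<Longrightarrow> transfer_matrix N E W = transfer_matrix N E W'"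
  by (induction N) (simp_all add: transfer_matrix_Suc)

lemma transfer_matrix_add:
  "transfer_matrix (m + n) E W = transfer_matrix m E (\<lambda>i. W (i + int n)) ** transfer_matrix n E W"
  by (induction m) (simp_all add: transfer_matrix_Suc matrix_mul_assoc)

lemma det_transfer [simp]: "det (transfer_matrix N E W) = 1"
  by (induction N) (simp_all add: transfer_matrix_Suc det_mul)

lemma op_norm_transfer_ge_1 [simp]: "1 \<le> op_norm (transfer_matrix N E W)"
  by (simp add: op_norm_ge_1_if_det_1)

lemma op_norm_transfer_le:
  assumes "0 \<le> B" "\<And>x. x < N \<Longrightarrow> \<bar>E - W (int x)\<bar> \<le> B"
  shows "op_norm (transfer_matrix N E W) \<le> (1 + B) ^ N"
  using assms(2)
proof (induction N)
  case 0
  then show ?case by (simp add: op_norm_mat_1)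
next
  case (Suc N)
  have "op_norm (transfer_matrix (Suc N) E W)
      \<le> op_norm (one_step_matrix E (W (int N))) * op_norm (transfer_matrix N E W)"
    by (simp add: transfer_matrix_Suc op_norm_mult)
  also have "\<dots> \<le> (1 + B) * (1 + B) ^ N"
    using Suc assms(1)
    by (intro mult_mono order_trans[OF op_norm_one_step]) auto
  finally show ?case by simp
qed

text \<open>Telescoping over the sites. The factor \<open>(1 + B) ^ N\<close> is harmless because
  the bound serves only at fixed \<open>N\<close>, with \<open>h\<close> tending to 0.\<close>

lemma op_norm_transfer_diff:
  assumes B: "0 \<le> B" "\<And>x. x < N \<Longrightarrow> \<bar>E - W (int x)\<bar> \<le> B" "\<And>x. x < N \<Longrightarrow> \<bar>E' - W' (int x)\<bar> \<le> B"
    and h: "0 \<le> h" "\<And>x. x < N \<Longrightarrow> \<bar>(E - W (int x)) - (E' - W' (int x))\<bar> \<le> h"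
  shows "op_norm (transfer_matrix N E W - transfer_matrix N E' W') \<le> real N * (1 + B) ^ N * h"
  using B(2,3) h(2)
proof (induction N)
  case 0
  have "op_norm 0 \<le> 0" using op_norm_scaleR[of 0 0] by simp
  then show ?case by simp
next
  case (Suc N)
  let ?M = "one_step_matrix E (W (int N))" and ?M' = "one_step_matrix E' (W' (int N))"
  let ?T = "transfer_matrix N E W" and ?T' = "transfer_matrix N E' W'"
  have "?M ** ?T - ?M' ** ?T' = ?M ** (?T - ?T') + (?M - ?M') ** ?T'"
    by (simp add: matrix_diff_ldistrib matrix_diff_rdistrib)
  then have "op_norm (?M ** ?T - ?M' ** ?T') \<le> op_norm ?M * op_norm (?T - ?T') + op_norm (?M - ?M') * op_norm ?T'"
    using order_trans[OF op_norm_add add_mono[OF op_norm_mult op_norm_mult]] by metis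
  also have "\<dots> \<le> (1 + B) * (real N * (1 + B) ^ N * h) + h * (1 + B) ^ N"
    using Suc.prems B(1) h(1)
    by (intro add_mono mult_mono Suc.IH op_norm_transfer_le order_trans[OF op_norm_one_step_diff]
        order_trans[OF op_norm_one_step]) auto
  also have "h * (1 + B) ^ N \<le> h * (1 + B) ^ Suc N"
    using B(1) h(1) by (intro mult_left_mono power_increasing) auto
  finally show ?case
    by (simp add: transfer_matrix_Suc algebra_simps)
qed

lemma ln_op_norm_transfer_diff:
  assumes B: "0 \<le> B" "\<And>x. x < N \<Longrightarrow> \<bar>E - W (int x)\<bar> \<le> B" "\<And>x. x < N \<Longrightarrow> \<bar>E' - W' (int x)\<bar> \<le> B"
    and h: "0 \<le> h" "\<And>x. x < N \<Longrightarrow> \<bar>(E - W (int x)) - (E' - W' (int x))\<bar> \<le> h"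
  shows "ln (op_norm (transfer_matrix N E W)) \<le> ln (op_norm (transfer_matrix N E' W')) + real N * (1 + B) ^ N * h"
proof -
  let ?a = "op_norm (transfer_matrix N E W)" and ?b = "op_norm (transfer_matrix N E' W')"
  have pos: "1 \<le> ?a" "1 \<le> ?b" by auto
  have "?a \<le> op_norm (transfer_matrix N E W - transfer_matrix N E' W') + ?b"
    using op_norm_add[of "transfer_matrix N E W - transfer_matrix N E' W'" "transfer_matrix N E' W'"] by simp
  also have "\<dots> \<le> real N * (1 + B) ^ N * h + ?b"
    using op_norm_transfer_diff[of B N E W E' W' h] assms by simp
  finally have d: "?a - ?b \<le> real N * (1 + B) ^ N * h" by simp
  have "ln ?a - ln ?b \<le> (?a - ?b) / ?b"
    using pos ln_diff_le[of ?a ?b] by linarith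
  also have "\<dots> \<le> real N * (1 + B) ^ N * h / 1"
  proof (rule frac_le)
    show "0 \<le> real N * (1 + B) ^ N * h" using B h by simp
  qed (use d pos in auto)
  finally show ?thesis by simp
qed

text \<open>Each site costs a factor 1 + C |W - V| and not a factor \<open>C\<close>. The
  unperturbed block of length \<open>m\<close> on the left is what makes this work: the unperturbed
  part of the next step merges into a longer block, again bounded by \<open>C\<close>, and only the
  difference is paid for.\<close>

lemma op_norm_transfer_perturb:
  assumes C: "\<And>m i. op_norm (transfer_matrix m E (\<lambda>x. V (x + i))) \<le> C"
  shows "op_norm (transfer_matrix m E (\<lambda>x. V (x + int l)) ** transfer_matrix l E W)
    \<le> C * (\<Prod>x<l. 1 + C * \<bar>W (int x) - V (int x)\<bar>)"
proof (induction l arbitrary: m)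
  case 0
  show ?case using C[of m 0] by simp
next
  case (Suc l)
  have C0: "0 \<le> C" using C[of 0 0] op_norm_nonneg order_trans by blast
  define P where "P = C * (\<Prod>x<l. 1 + C * \<bar>W (int x) - V (int x)\<bar>)"
  let ?R = "transfer_matrix l E W" and ?v = "V (int l)" and ?w = "W (int l)"
  let ?Tm = "transfer_matrix m E (\<lambda>x. V (x + int (Suc l)))"
  have "transfer_matrix (Suc m) E (\<lambda>x. V (x + int l)) = ?Tm ** one_step_matrix E ?v"
    using transfer_matrix_add[of m 1 E "\<lambda>x. V (x + int l)"]
    by (simp add: transfer_matrix_Suc add.assoc)
  then have eq: "?Tm ** transfer_matrix (Suc l) E W = transfer_matrix (Suc m) E (\<lambda>x. V (x + int l)) ** ?R
      + ?Tm ** ((one_step_matrix E ?w - one_step_matrix E ?v) ** ?R)"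
    by (simp add: transfer_matrix_Suc matrix_mul_assoc matrix_diff_ldistrib matrix_diff_rdistrib)
  have R: "op_norm ?R \<le> P" using Suc.IH[of 0] by (simp add: P_def)
  have "op_norm (?Tm ** ((one_step_matrix E ?w - one_step_matrix E ?v) ** ?R))
      \<le> op_norm ?Tm * (op_norm (one_step_matrix E ?w - one_step_matrix E ?v) * op_norm ?R)"
    by (rule order_trans[OF op_norm_mult]) (intro mult_left_mono op_norm_mult op_norm_nonneg)
  also have "\<dots> \<le> C * (\<bar>?w - ?v\<bar> * P)"
    using op_norm_one_step_diff[of E ?w E ?v] C0 C
    by (intro mult_mono mult_nonneg_nonneg R order_trans[OF op_norm_nonneg R]) auto
  finally have "op_norm (?Tm ** transfer_matrix (Suc l) E W) \<le> P + C * (\<bar>?w - ?v\<bar> * P)"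
    unfolding eq using Suc.IH[of "Suc m"] order_trans[OF op_norm_add add_mono] by (simp add: P_def)
  then show ?case by (simp add: P_def algebra_simps)
qed

text \<open>Only the summed deviation enters, so a strong but sparse change and a uniformly tiny one
  are both cheap per site.\<close>

lemma ln_op_norm_transfer_perturb:
  assumes C: "\<And>m i. op_norm (transfer_matrix m E (\<lambda>x. V (x + i))) \<le> C"
  shows "ln (op_norm (transfer_matrix l E W)) \<le> ln C + C * (\<Sum>x<l. \<bar>W (int x) - V (int x)\<bar>)"
proof -
  have C1: "1 \<le> C" using C[of 0 0] op_norm_transfer_ge_1 order_trans by blast
  have pos: "0 < 1 + C * \<bar>W (int x) - V (int x)\<bar>" for x
    using C1 by (simp add: add_pos_nonneg)
  have "op_norm (transfer_matrix l E W) \<le> C * (\<Prod>x<l. 1 + C * \<bar>W (int x) - V (int x)\<bar>)"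
    using op_norm_transfer_perturb[OF C, of 0 l W] by simp
  then have "ln (op_norm (transfer_matrix l E W)) \<le> ln (C * (\<Prod>x<l. 1 + C * \<bar>W (int x) - V (int x)\<bar>))"
    using op_norm_transfer_ge_1[of l E W] C1 by (intro ln_mono) linarith+
  also have "\<dots> = ln C + (\<Sum>x<l. ln (1 + C * \<bar>W (int x) - V (int x)\<bar>))"
  proof -
    have "(\<Prod>x<l. 1 + C * \<bar>W (int x) - V (int x)\<bar>) > 0" by (intro prod_pos) (use pos in auto)
    then show ?thesis using C1 by (simp add: ln_mult_pos) (rule ln_prod, simp, metis pos less_irrefl)
  qed
  also have "\<dots> \<le> ln C + (\<Sum>x<l. C * \<bar>W (int x) - V (int x)\<bar>)"
    using C1 by (intro add_left_mono sum_mono ln_add_one_self_le_self) auto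
  finally show ?thesis by (simp add: sum_distrib_left)
qed

section \<open>The hull and its invariant measure\<close>

lemma potential_Cauchy_convergent:
  fixes f :: "nat \<Rightarrow> potential"
  assumes "Cauchy f"
  shows "convergent f"
proof -
  obtain g where "uniform_limit UNIV (\<lambda>n. apply_bcontfun (f n)) g sequentially"
    using uniformly_convergent_eq_cauchy[of "\<lambda>_. True" "\<lambda>n. apply_bcontfun (f n)"] assms
    unfolding Cauchy_def uniform_limit_sequentially_iff
    by (metis dist_fun_lt_imp_dist_val_lt)
  from uniform_limit_bcontfunE[OF this sequentially_bot] show ?thesis
    by (metis convergentI)
qed

lemma complete_potential_if_closed:
  fixes S :: "potential set"
  assumes "closed S"
  shows "uniform_space_class.complete S"
proof (rule completeI)
  fix f assume f: "\<forall>n. f n \<in> S" "Cauchy f"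
  then obtain l where "f \<longlonglongrightarrow> l" using potential_Cauchy_convergent unfolding convergent_def by blast
  then show "\<exists>l\<in>S. f \<longlonglongrightarrow> l" using f(1) closed_sequentially[OF assms] by blast
qed

lemma translate_0 [simp]: "translate 0 V = V"
  by (rule bcontfun_eqI) simp

lemma translate_translate [simp]: "translate m (translate n V) = translate (m + n) V"
  by (rule bcontfun_eqI) (simp add: algebra_simps)

lemma dist_translate [simp]: "dist (translate m V) (translate m W) = dist V W"
proof -
  have le: "dist (translate m V) (translate m W) \<le> dist V W" for m V W
    by (rule dist_bound) (simp add: dist_bounded)
  show ?thesis
    using le[of m V W] le[of "- m" "translate m V" "translate m W"] by simp
qed

lemma continuous_on_translate: "continuous_on S (translate m)"
  by (auto simp: continuous_on_iff)

lemma translate_mult_period: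
  assumes "translate (int p) V = V"
  shows "translate (int p * q) V = V"
proof -
  have nonneg: "translate (int p * int n) V = V" for n
  proof (induction n)
    case (Suc n)
    have "translate (int p * int (Suc n)) V = translate (int p) (translate (int p * int n) V)"
      by (simp add: algebra_simps)
    then show ?case by (simp add: Suc assms)
  qed simp
  show ?thesis
  proof (cases q)
    case (nonneg n)
    then show ?thesis using \<open>\<And>n. translate (int p * int n) V = V\<close> by simp
  next
    case (neg n)
    have "translate (int p * q) (translate (int p * int (Suc n)) V) = translate 0 V"
      unfolding translate_translate by (rule arg_cong2[where f = translate]) (simp_all add: neg algebra_simps)
    then show ?thesis by (simp only: nonneg translate_0)
  qed
qed

text \<open>The two translates of the periodic \<open>W\<close> coincide, and each is at distance
  \<open>dist W V\<close> from the corresponding translate of \<open>V\<close>. Compactness of the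
  hull, unique ergodicity and the construction of the Haar measure all rest on this.\<close>

lemma dist_translate_cong_mod:
  assumes "translate (int p) W = W" "int p dvd m - m'"
  shows "dist (translate m V) (translate m' V) \<le> 2 * dist W V"
proof -
  obtain q where q: "m - m' = int p * q" using assms(2) by blast
  have "translate m W = translate m' (translate (int p * q) W)"
    by (simp flip: q)
  then have "translate m W = translate m' W"
    by (simp only: translate_mult_period[OF assms(1)])
  then have "dist (translate m V) (translate m' V)
      \<le> dist (translate m V) (translate m W) + dist (translate m' W) (translate m' V)"
    by (metis dist_triangle)
  then show ?thesis by (simp add: dist_commute)
qed

lemma translate_in_hull [simp]: "translate m V \<in> potential_hull V"
  unfolding potential_hull_def by (intro closure_subset[THEN subsetD]) auto

lemma closed_hull [simp]: "closed (potential_hull V)"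
  by (simp add: potential_hull_def)

lemma hull_approx:
  assumes "W \<in> potential_hull V" "0 < e"
  obtains m where "dist (translate m V) W < e"
  using assms unfolding potential_hull_def closure_approachable by blast

lemma translate_hull:
  assumes "W \<in> potential_hull V"
  shows "translate m W \<in> potential_hull V"
  unfolding potential_hull_def closure_approachable
proof (intro allI impI)
  fix e :: real assume "0 < e"
  then obtain n where "dist (translate n V) W < e" using hull_approx assms by blast
  then have "dist (translate (m + n) V) (translate m W) < e"
    using dist_translate[of m "translate n V" W] by simp
  then show "\<exists>y\<in>range (\<lambda>m. translate m V). dist y (translate m W) < e" by blast
qed

lemma norm_hull_le:
  assumes "W \<in> potential_hull V"
  shows "norm W \<le> norm V"
proof -
  have "potential_hull V \<subseteq> cball 0 (norm V)"
    unfolding potential_hull_def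
  proof (rule closure_minimal)
    show "range (\<lambda>m. translate m V) \<subseteq> cball 0 (norm V)"
    proof clarify
      fix m
      have "norm (translate m V) \<le> norm V"
        by (rule norm_bound) (use norm_bounded[of V] in simp)
      then show "translate m V \<in> cball 0 (norm V)" by simp
    qed
  qed auto
  with assms show ?thesis by (auto simp: subset_iff)
qed

lemma bij_betw_add_mod:
  assumes "0 < P"
  shows "bij_betw (\<lambda>j. nat ((int j + m) mod int P)) {..<P} {..<P}"
proof -
  have inj: "inj_on (\<lambda>j. nat ((int j + m) mod int P)) {..<P}"
  proof (rule inj_onI)
    fix j j' assume *: "j \<in> {..<P}" "j' \<in> {..<P}"
      "nat ((int j + m) mod int P) = nat ((int j' + m) mod int P)"
    then have "(int j + m) mod int P = (int j' + m) mod int P"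
      using assms by (simp add: nat_eq_iff)
    then have "int P dvd (int j + m) - (int j' + m)" by (rule mod_eq_dvd_iff[THEN iffD1])
    then have "int P dvd int j - int j'" by simp
    then have "int j mod int P = int j' mod int P" by (rule mod_eq_dvd_iff[THEN iffD2])
    with * show "j = j'" by simp
  qed
  have "(\<lambda>j. nat ((int j + m) mod int P)) ` {..<P} \<subseteq> {..<P}"
    using assms by (auto simp: nat_less_iff)
  then show ?thesis using inj by (simp add: bij_betw_def endo_inj_surj)
qed

section \<open>Invariant probability measures on the hull\<close>

definition hull_invariant :: "potential \<Rightarrow> potential measure \<Rightarrow> bool" where
  "hull_invariant V \<mu> \<longleftrightarrow> sets \<mu> = sets (restrict_space borel (potential_hull V)) \<and>
     prob_space \<mu> \<and> distr \<mu> \<mu> (translate 1) = \<mu>"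

lemma borel_measurable_hull:
  fixes f :: "potential \<Rightarrow> real"
  assumes "continuous_on (potential_hull V) f" "sets \<mu> = sets (restrict_space borel (potential_hull V))"
  shows "f \<in> borel_measurable \<mu>"
  using borel_measurable_continuous_on_restrict[OF assms(1)] measurable_cong_sets[OF assms(2) refl]
  by blast

lemma translate_measurable_hull:
  assumes "sets \<mu> = sets (restrict_space borel (potential_hull V))"
  shows "translate m \<in> measurable \<mu> \<mu>"
proof -
  have "translate m \<in> measurable (restrict_space borel (potential_hull V)) (restrict_space borel (potential_hull V))"
    by (rule measurable_restrict_space3)
       (auto intro: borel_measurable_continuous_onI continuous_on_translate translate_hull)
  then show ?thesis using measurable_cong_sets[OF assms assms] by blast
qed

lemma space_hull:
  assumes "sets \<mu> = sets (restrict_space borel (potential_hull V))"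
  shows "space \<mu> = potential_hull V"
  using sets_eq_imp_space_eq[OF assms] by (simp add: space_restrict_space)

lemma continuous_on_comp_translate:
  assumes "continuous_on (potential_hull V) f"
  shows "continuous_on (potential_hull V) (\<lambda>W. f (translate m W))"
  by (rule continuous_on_compose2[OF assms continuous_on_translate]) (auto intro: translate_hull)

lemma integral_translate:
  fixes f :: "potential \<Rightarrow> real"
  assumes \<mu>: "hull_invariant V \<mu>" and f: "continuous_on (potential_hull V) f"
  shows "(\<integral>W. f (translate (int j) W) \<partial>\<mu>) = (\<integral>W. f W \<partial>\<mu>)"
proof (induction j)
  case (Suc j)
  have s: "sets \<mu> = sets (restrict_space borel (potential_hull V))" and d: "distr \<mu> \<mu> (translate 1) = \<mu>"
    using \<mu> by (auto simp: hull_invariant_def)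
  have "(\<integral>W. f (translate (int j) W) \<partial>\<mu>) = (\<integral>W. f (translate (int j) W) \<partial>distr \<mu> \<mu> (translate 1))"
    by (simp add: d)
  also have "\<dots> = (\<integral>W. f (translate (int j) (translate 1 W)) \<partial>\<mu>)"
    by (rule integral_distr)
       (auto intro: translate_measurable_hull[OF s] borel_measurable_hull[OF _ s] continuous_on_comp_translate f)
  finally show ?case using Suc by (simp add: add.commute)
qed simp

text \<open>The functions max 0 (1 - n dist(x, F)) decrease to the indicator of a closed set
  \<open>F\<close>, and closed sets form an intersection-stable generator. Both measures are pushed
  to the whole space by \<open>id\<close>, where this generator is available.\<close>

lemma finite_measure_eqI_continuous:
  fixes S :: "'a::metric_space set"
  assumes "finite_measure M" "finite_measure N" "closed S"
    and sM: "sets M = sets (restrict_space borel S)" and sN: "sets N = sets (restrict_space borel S)"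
    and eq: "\<And>f::'a \<Rightarrow> real. continuous_on S f \<Longrightarrow> (\<integral>x. f x \<partial>M) = (\<integral>x. f x \<partial>N)"
  shows "M = N"
proof -
  interpret M: finite_measure M by fact
  interpret N: finite_measure N by fact
  have lim: "(\<lambda>n. \<integral>x. max 0 (1 - real n * infdist x F) \<partial>L) \<longlonglongrightarrow> measure L (F \<inter> S)"
    if F: "closed F" "F \<noteq> {}" and L: "finite_measure L" "sets L = sets (restrict_space borel S)" for F L
  proof -
    interpret L: finite_measure L by fact
    have sp: "space L = S" using sets_eq_imp_space_eq[OF L(2)] by (simp add: space_restrict_space)
    have meas: "g \<in> borel_measurable L" if "g \<in> borel_measurable borel" for g :: "'a \<Rightarrow> real"
      using measurable_restrict_space1[OF that] measurable_cong_sets[OF L(2) refl] by blast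
    have "(\<lambda>n. \<integral>x. max 0 (1 - real n * infdist x F) \<partial>L) \<longlonglongrightarrow> (\<integral>x. indicator F x \<partial>L)"
    proof (rule integral_dominated_convergence[where w = "\<lambda>_. 1"])
      show "AE x in L. (\<lambda>n. max 0 (1 - real n * infdist x F)) \<longlonglongrightarrow> indicator F x"
      proof (rule AE_I2)
        fix x
        show "(\<lambda>n. max 0 (1 - real n * infdist x F)) \<longlonglongrightarrow> indicator F x"
        proof (cases "x \<in> F")
          case False
          then have pos: "infdist x F > 0"
            using F infdist_pos_not_in_closed by blast
          then obtain n0 :: nat where n0: "1 / infdist x F < real n0" using reals_Archimedean2 by blast
          have *: "max 0 (1 - real n * infdist x F) = 0" if "n0 \<le> n" for n
          proof -
            from that
            have "1 / infdist x F < real n" using n0 by linarith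
            then have "1 < real n * infdist x F" using pos by (simp add: field_simps)
            then show "max 0 (1 - real n * infdist x F) = 0" by simp
          qed
          have "\<forall>\<^sub>F n in sequentially. max 0 (1 - real n * infdist x F) = indicator F x"
            using eventually_ge_at_top[of n0] by eventually_elim (use * False in simp)
          then show ?thesis by (rule tendsto_eventually)
        qed (use F in \<open>simp add: infdist_zero\<close>)
      qed
      show "AE x in L. norm (max 0 (1 - real n * infdist x F)) \<le> 1" for n
        by (auto simp: infdist_nonneg)
      show "(indicator F :: 'a \<Rightarrow> real) \<in> borel_measurable L"
        by (rule meas) (use F in \<open>simp add: borel_closed\<close>)
      show "(\<lambda>x. max 0 (1 - real n * infdist x F)) \<in> borel_measurable L" for n
        by (intro meas borel_measurable_continuous_onI continuous_intros)
    qed simp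
    also have "(\<integral>x. indicator F x \<partial>L) = measure L (F \<inter> S)"
      by (simp add: sp)
    finally show ?thesis .
  qed
  have eqF: "measure M (F \<inter> S) = measure N (F \<inter> S)" if "closed F" for F
  \<comment> \<open>\<open>infdist x {}\<close> is 0 by convention, so for empty \<open>F\<close>
    the approximating functions would be constantly 1.\<close>
  proof (cases "F = {}")
    case False
    have "(\<integral>x. max 0 (1 - real n * infdist x F) \<partial>M) = (\<integral>x. max 0 (1 - real n * infdist x F) \<partial>N)" for n
      by (intro eq continuous_intros)
    then show ?thesis
      using lim[OF that False assms(1) sM] lim[OF that False assms(2) sN]
      by (simp add: LIMSEQ_unique)
  qed simp
  have spM: "space M = S" and spN: "space N = S"
    using sets_eq_imp_space_eq[OF sM] sets_eq_imp_space_eq[OF sN] by (simp_all add: space_restrict_space)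
  have id: "id \<in> measurable L borel" if "sets L = sets (restrict_space borel S)" for L :: "'a measure"
    using measurable_cong_sets[OF that refl, of borel] measurable_restrict_space1[of id borel borel S] by auto
  have "distr M borel id = distr N borel id"
  proof (rule measure_eqI_generator_eq[where E = "Collect closed" and \<Omega> = UNIV and A = "\<lambda>_. UNIV"])
    show "Int_stable (Collect closed)" by (auto simp: Int_stable_def)
    show "emeasure (distr M borel id) X = emeasure (distr N borel id) X" if "X \<in> Collect closed" for X
      using that eqF[of X]
      by (simp add: emeasure_distr id sM sN spM spN borel_closed M.emeasure_eq_measure N.emeasure_eq_measure)
    show "emeasure (distr M borel id) UNIV \<noteq> \<infinity>"
      by (simp add: emeasure_distr id sM M.emeasure_eq_measure)
  qed (auto simp: borel_eq_closed)
  then have *: "emeasure (distr M borel id) A = emeasure (distr N borel id) A" for A by simp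
  show ?thesis
  proof (rule measure_eqI)
    fix A assume "A \<in> sets M"
    then have "A \<in> sets borel" "A \<subseteq> S"
      using \<open>closed S\<close> unfolding sM by (auto simp: sets_restrict_space_iff borel_closed)
    then show "emeasure M A = emeasure N A"
      using *[of A] by (simp add: emeasure_distr id sM sN spM spN Int_absorb2)
  qed (simp add: sM sN)
qed

text \<open>Divisibility of consecutive periods makes the residues modulo \<open>p k\<close> refine
  each other, so the hull is a continuous image of the inverse limit of the groups Z / p k.\<close>

locale limit_periodic_chain =
  fixes V :: potential and Vk :: "nat \<Rightarrow> potential" and p :: "nat \<Rightarrow> nat"
  assumes conv: "Vk \<longlonglongrightarrow> V"
    and periodic: "\<And>k. translate (int (p k)) (Vk k) = Vk k"
    and pos: "\<And>k. 0 < p k"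
    and dvd: "\<And>k. p k dvd p (Suc k)"
begin

lemma dist_0: "(\<lambda>k. dist (Vk k) V) \<longlonglongrightarrow> 0"
  by (rule tendsto_dist_iff[THEN iffD1, OF conv])

lemma dist_small: "0 < e \<Longrightarrow> \<exists>K. \<forall>k\<ge>K. dist (Vk k) V < e"
  using conv by (simp add: lim_sequentially)

lemma dist_cong: "int (p k) dvd m - m' \<Longrightarrow> dist (translate m V) (translate m' V) \<le> 2 * dist (Vk k) V"
  by (rule dist_translate_cong_mod[OF periodic])

text \<open>The translates by a full set of residues modulo \<open>p k\<close> form a finite net, by
  \<open>dist_cong\<close>. Closed balls of half the radius are used so that the covering passes to
  the closure of the orbit.\<close>

lemma compact_hull: "compact (potential_hull V)"
  unfolding compact_eq_totally_bounded
proof (intro conjI allI impI)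
  show "uniform_space_class.complete (potential_hull V)"
    by (rule complete_potential_if_closed[OF closed_hull])
  fix e :: real assume e: "0 < e"
  then obtain k where k: "dist (Vk k) V < e / 4" using dist_small[of "e / 4"] by auto
  let ?N = "(\<lambda>j. translate (int j) V) ` {..<p k}"
  have "potential_hull V \<subseteq> (\<Union>x\<in>?N. cball x (e / 2))"
    unfolding potential_hull_def
  proof (rule closure_minimal)
    show "range (\<lambda>m. translate m V) \<subseteq> (\<Union>x\<in>?N. cball x (e / 2))"
    proof clarify
      fix m :: int
      let ?j = "nat (m mod int (p k))"
      have j: "?j < p k" "int (p k) dvd int ?j - m"
        using pos[of k] by (auto simp: nat_less_iff mod_eq_dvd_iff[symmetric])
      have "dist (translate (int ?j) V) (translate m V) \<le> e / 2"
        using dist_cong[OF j(2)] k by simp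
      then show "translate m V \<in> (\<Union>x\<in>?N. cball x (e / 2))"
        using j(1) by (intro UN_I[of "translate (int ?j) V"] imageI) simp_all
    qed
    show "closed (\<Union>x\<in>?N. cball x (e / 2))" by (intro closed_UN) auto
  qed
  also have "\<dots> \<subseteq> (\<Union>x\<in>?N. ball x e)" using e by auto
  finally show "\<exists>N. finite N \<and> potential_hull V \<subseteq> (\<Union>x\<in>N. ball x e)" by blast
qed

lemma bounded_on_hull:
  fixes f :: "potential \<Rightarrow> real"
  assumes "continuous_on (potential_hull V) f"
  obtains B where "\<And>W. W \<in> potential_hull V \<Longrightarrow> \<bar>f W\<bar> \<le> B"
proof -
  have "bounded (f ` potential_hull V)"
    by (intro compact_imp_bounded compact_continuous_image assms compact_hull)
  then show ?thesis using that by (auto simp: bounded_iff)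
qed

lemma integrable_hull:
  fixes f :: "potential \<Rightarrow> real"
  assumes "continuous_on (potential_hull V) f" "finite_measure \<mu>"
    "sets \<mu> = sets (restrict_space borel (potential_hull V))"
  shows "integrable \<mu> f"
proof -
  obtain B where "\<And>W. W \<in> potential_hull V \<Longrightarrow> \<bar>f W\<bar> \<le> B" using bounded_on_hull assms(1) by blast
  then show ?thesis
    using borel_measurable_hull[OF assms(1,3)]
    by (intro finite_measure.integrable_const_bound[OF assms(2), where B = B] AE_I2)
       (auto simp: space_hull[OF assms(3)])
qed

text \<open>A sum over \<open>p k\<close> consecutive translates hardly depends on its starting
  point \<open>W\<close>: replacing \<open>W\<close> by a translate of \<open>V\<close> and reducing
  shifts modulo \<open>p k\<close> only permutes the terms up to a small error. Integrating over
  \<open>W\<close> therefore compares the sum at \<open>V\<close> with \<open>p k\<close> times the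
  integral.\<close>

lemma average_tendsto_integral:
  fixes f :: "potential \<Rightarrow> real"
  assumes \<mu>: "hull_invariant V \<mu>" and f: "continuous_on (potential_hull V) f"
  shows "(\<lambda>k. (\<Sum>j<p k. f (translate (int j) V)) / real (p k)) \<longlonglongrightarrow> (\<integral>W. f W \<partial>\<mu>)"
proof (rule LIMSEQ_I)
  fix r :: real assume r: "0 < r"
  define e where "e = r / 3"
  have e: "0 < e" using r by (simp add: e_def)
  have s: "sets \<mu> = sets (restrict_space borel (potential_hull V))" and "prob_space \<mu>"
    using \<mu> by (auto simp: hull_invariant_def)
  interpret prob_space \<mu> by fact
  have "uniformly_continuous_on (potential_hull V) f"
    by (rule compact_uniformly_continuous[OF f compact_hull])
  then obtain d where d: "0 < d" "\<And>W W'. W \<in> potential_hull V \<Longrightarrow> W' \<in> potential_hull V \<Longrightarrow>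
      dist W' W < d \<Longrightarrow> \<bar>f W' - f W\<bar> < e"
    unfolding uniformly_continuous_on_def dist_real_def using e by metis
  obtain K where K: "\<forall>k\<ge>K. dist (Vk k) V < d / 2" using dist_small[of "d / 2"] d(1) by auto
  have "norm ((\<Sum>j<p k. f (translate (int j) V)) / real (p k) - (\<integral>W. f W \<partial>\<mu>)) < r" if "k \<ge> K" for k
  proof -
    let ?P = "p k"
    define S where "S W = (\<Sum>j<?P. f (translate (int j) W))" for W
    have P: "0 < ?P" by (rule pos)
    have close: "\<bar>S W - S V\<bar> \<le> 2 * e * ?P" if W: "W \<in> potential_hull V" for W
    proof -
      obtain m where m: "dist (translate m V) W < d" using hull_approx[OF W d(1)] by blast
      let ?g = "\<lambda>j. nat ((int j + m) mod int ?P)"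
      have "S V = (\<Sum>j<?P. f (translate (int (?g j)) V))"
        unfolding S_def by (rule sum.reindex_bij_betw[OF bij_betw_add_mod[OF P], symmetric])
      then have "\<bar>S W - S V\<bar> = \<bar>\<Sum>j<?P. f (translate (int j) W) - f (translate (int (?g j)) V)\<bar>"
        by (simp add: S_def sum_subtractf)
      also have "\<dots> \<le> (\<Sum>j<?P. \<bar>f (translate (int j) W) - f (translate (int (?g j)) V)\<bar>)"
        by (rule sum_abs)
      also have "\<dots> \<le> (\<Sum>j<?P. 2 * e)"
      proof (rule sum_mono)
        fix j
        have "dist (translate (int j) (translate m V)) (translate (int j) W) < d"
          using m by (simp only: dist_translate)
        then have 1: "\<bar>f (translate (int j) (translate m V)) - f (translate (int j) W)\<bar> < e"
          by (intro d(2) translate_hull W translate_in_hull)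
        have "int ?P dvd int (?g j) - (int j + m)"
          using P by (simp add: mod_eq_dvd_iff[symmetric])
        then have "dist (translate (int (?g j)) V) (translate (int j + m) V) < d"
          using K \<open>k \<ge> K\<close>
          by (intro le_less_trans[OF dist_cong[of k]]) auto
        then have 2: "\<bar>f (translate (int (?g j)) V) - f (translate (int j + m) V)\<bar> < e"
          by (intro d(2)) auto
        show "\<bar>f (translate (int j) W) - f (translate (int (?g j)) V)\<bar> \<le> 2 * e"
          using 1 2 by simp
      qed
      finally show ?thesis by (simp add: mult.commute)
    qed
    have int: "integrable \<mu> (\<lambda>W. f (translate (int j) W))" for j
      by (intro integrable_hull[OF _ _ s] continuous_on_comp_translate f) unfold_locales
    have "(\<integral>W. S W - S V \<partial>\<mu>) = (\<integral>W. S W \<partial>\<mu>) - S V"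
      using int by (simp add: S_def prob_space)
    also have "(\<integral>W. S W \<partial>\<mu>) = ?P * (\<integral>W. f W \<partial>\<mu>)"
      unfolding S_def using int by (subst Bochner_Integration.integral_sum) (auto simp: integral_translate[OF \<mu> f])
    finally have eq: "(\<integral>W. S W - S V \<partial>\<mu>) = ?P * (\<integral>W. f W \<partial>\<mu>) - S V" .
    have int': "integrable \<mu> (\<lambda>W. S W - S V)" unfolding S_def using int by auto
    have "S W - S V \<le> 2 * e * ?P" "- (2 * e * ?P) \<le> S W - S V" if "W \<in> potential_hull V" for W
      using close[OF that] by linarith+
    then have "AE W in \<mu>. S W - S V \<le> 2 * e * ?P" "AE W in \<mu>. - (2 * e * ?P) \<le> S W - S V"
      by (auto intro!: AE_I2 simp: space_hull[OF s])
    then have "\<bar>?P * (\<integral>W. f W \<partial>\<mu>) - S V\<bar> \<le> 2 * e * ?P"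
      using integral_le_const[OF int', of "2 * e * ?P"] integral_ge_const[OF int', of "- (2 * e * ?P)"]
      unfolding eq by linarith
    moreover have "\<bar>?P * (\<integral>W. f W \<partial>\<mu>) - S V\<bar> = \<bar>S V / ?P - (\<integral>W. f W \<partial>\<mu>)\<bar> * ?P"
    proof -
      have "?P * (\<integral>W. f W \<partial>\<mu>) - S V = - ((S V / ?P - (\<integral>W. f W \<partial>\<mu>)) * ?P)"
        using P by (simp add: left_diff_distrib)
      then show ?thesis by (simp only: abs_minus_cancel abs_mult abs_of_nat)
    qed
    ultimately have "\<bar>S V / ?P - (\<integral>W. f W \<partial>\<mu>)\<bar> \<le> 2 * e" using P by simp
    then show ?thesis using r by (simp add: e_def S_def)
  qed
  then show "\<exists>K. \<forall>k\<ge>K. norm ((\<Sum>j<p k. f (translate (int j) V)) / real (p k) - (\<integral>W. f W \<partial>\<mu>)) < r" by blast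
qed

lemma hull_invariant_unique:
  assumes "hull_invariant V \<mu>" "hull_invariant V \<nu>"
  shows "\<mu> = \<nu>"
proof (rule finite_measure_eqI_continuous[where S = "potential_hull V"])
  show "(\<integral>x. f x \<partial>\<mu>) = (\<integral>x. f x \<partial>\<nu>)" if "continuous_on (potential_hull V) f" for f :: "potential \<Rightarrow> real"
    using LIMSEQ_unique average_tendsto_integral[OF _ that] assms by blast
qed (use assms in \<open>auto simp: hull_invariant_def prob_space_def\<close>)

text \<open>The numbers \<open>\<lfloor>p k * \<omega>\<rfloor>\<close> share their leading digits. Reversing the order of the digits turns
  them into numbers that are congruent modulo \<open>p k\<close> from index \<open>k\<close> on, so the translates of \<open>V\<close> by
  them converge; the law of the limit for uniform \<open>\<omega>\<close> is the Haar measure.\<close>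

primrec digit_perm :: "nat \<Rightarrow> nat \<Rightarrow> nat" where
  "digit_perm 0 q = q"
| "digit_perm (Suc k) q =
     digit_perm k (q div (p (Suc k) div p k)) + p k * (q mod (p (Suc k) div p k))"

lemma bij_digit_perm: "bij_betw (digit_perm k) {..<p k} {..<p k}"
proof (induction k)
  case 0
  show ?case by (simp add: bij_betw_def inj_on_def)
next
  case (Suc k)
  define r where "r = p (Suc k) div p k"
  have pr: "p (Suc k) = p k * r" using dvd[of k] by (simp add: r_def)
  have r: "0 < r" using pos[of "Suc k"] pr by (cases r) auto
  have lt: "digit_perm k (q div r) < p k" if "q < p (Suc k)" for q
    using bij_betw_apply[OF Suc, of "q div r"] that r by (simp add: pr less_mult_imp_div_less)
  have eq: "digit_perm (Suc k) q = digit_perm k (q div r) + p k * (q mod r)" for q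
    by (simp add: r_def)
  have inj: "inj_on (digit_perm (Suc k)) {..<p (Suc k)}"
  proof (rule inj_onI)
    fix q q' assume q: "q \<in> {..<p (Suc k)}" "q' \<in> {..<p (Suc k)}"
      "digit_perm (Suc k) q = digit_perm (Suc k) q'"
    have recover: "digit_perm (Suc k) q mod p k = digit_perm k (q div r)"
      "digit_perm (Suc k) q div p k = q mod r" if "q < p (Suc k)" for q
      using lt[OF that] pos[of k] unfolding eq by simp_all
    have "digit_perm k (q div r) = digit_perm k (q' div r)" "q mod r = q' mod r"
      using recover[of q] recover[of q'] q(1,2) unfolding q(3) lessThan_iff by metis+
    moreover have "q div r \<in> {..<p k}" "q' div r \<in> {..<p k}"
      using q r by (auto simp: pr less_mult_imp_div_less)
    ultimately show "q = q'"
      using bij_betw_imp_inj_on[OF Suc] by (metis inj_onD mult_div_mod_eq)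
  qed
  have "digit_perm (Suc k) q < p (Suc k)" if "q < p (Suc k)" for q
  proof -
    have "digit_perm (Suc k) q < p k + p k * (q mod r)" unfolding eq using lt[OF that] by simp
    also have "\<dots> = p k * Suc (q mod r)" by simp
    also have "\<dots> \<le> p k * r" using r by (intro mult_left_mono Suc_leI) auto
    finally show ?thesis by (simp add: pr)
  qed
  then have "digit_perm (Suc k) ` {..<p (Suc k)} \<subseteq> {..<p (Suc k)}" by blast
  then show ?case unfolding bij_betw_def using inj endo_inj_surj[OF finite_lessThan] by blast
qed

definition digit_index :: "nat \<Rightarrow> real \<Rightarrow> nat" where
  "digit_index k \<omega> = digit_perm k (nat \<lfloor>real (p k) * \<omega>\<rfloor>)"

lemma dvd_mono: "k \<le> l \<Longrightarrow> p k dvd p l"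
  by (induction l rule: dec_induct) (auto intro: dvd_trans dvd)

text \<open>The floor at level \<open>k\<close> is the floor at the next level divided by the
  quotient of the periods. Thus passing to the next level appends one digit, which digit reversal
  places at a multiple of \<open>p k\<close>.\<close>

lemma digit_index_Suc:
  assumes "0 \<le> \<omega>"
  shows "int (p k) dvd int (digit_index (Suc k) \<omega>) - int (digit_index k \<omega>)"
proof -
  define r where "r = p (Suc k) div p k"
  have pr: "p (Suc k) = p k * r" using dvd[of k] by (simp add: r_def)
  have r: "0 < r" using pos[of "Suc k"] pr by (cases r) auto
  have "\<lfloor>real (p k) * \<omega>\<rfloor> = \<lfloor>real (p (Suc k)) * \<omega> / real_of_int (int r)\<rfloor>"
    using r by (simp add: pr)
  also have "\<dots> = \<lfloor>real (p (Suc k)) * \<omega>\<rfloor> div int r"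
    by (rule floor_divide_real_eq_div) simp
  finally have "nat \<lfloor>real (p k) * \<omega>\<rfloor> = nat \<lfloor>real (p (Suc k)) * \<omega>\<rfloor> div r"
    by (simp add: nat_div_distrib')
  then show ?thesis
    by (simp add: digit_index_def r_def)
qed

lemma digit_index_le:
  assumes "0 \<le> \<omega>" "k \<le> l"
  shows "int (p k) dvd int (digit_index l \<omega>) - int (digit_index k \<omega>)"
  using assms(2)
proof (induction l rule: dec_induct)
  case (step l)
  have "int (p k) dvd int (digit_index (Suc l) \<omega>) - int (digit_index l \<omega>)"
    by (rule dvd_trans[OF _ digit_index_Suc[OF assms(1)]]) (use dvd_mono step in simp)
  from dvd_add[OF this step.IH] show ?case by simp
qed simp

abbreviation unit_measure :: "real measure" where
  "unit_measure \<equiv> restrict_space lborel {0..<1}"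

lemma prob_space_unit: "prob_space unit_measure"
  by (rule prob_spaceI) (simp add: space_restrict_space emeasure_restrict_space)

lemma digit_index_measurable: "digit_index k \<in> measurable borel (count_space UNIV)"
  unfolding digit_index_def by measurable

text \<open>For uniform \<omega> the floor is uniform on the residues, and \<open>digit_perm\<close>
  permutes them. Orbit averages thereby become exact expectations.\<close>

lemma integral_digit_index:
  fixes h :: "nat \<Rightarrow> real"
  shows "(\<integral>\<omega>. h (digit_index k \<omega>) \<partial>unit_measure) = (\<Sum>j<p k. h j) / real (p k)"
proof -
  let ?P = "real (p k)"
  have P: "0 < ?P" using pos by simp
  let ?I = "\<lambda>q::nat. {real q / ?P ..< (real q + 1) / ?P}"
  have eq: "indicator {0..<1} \<omega> *\<^sub>R h (digit_index k \<omega>)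
      = (\<Sum>q<p k. h (digit_perm k q) * indicator (?I q) \<omega>)" for \<omega> :: real
  proof -
    have mem: "\<omega> \<in> ?I q \<longleftrightarrow> \<lfloor>?P * \<omega>\<rfloor> = int q" for q
      using P by (simp add: floor_eq_iff field_simps)
    show ?thesis
    proof (cases "\<omega> \<in> {0..<1}")
      case True
      let ?q = "nat \<lfloor>?P * \<omega>\<rfloor>"
      have nn: "0 \<le> \<lfloor>?P * \<omega>\<rfloor>" using True P by simp
      have "?P * \<omega> < ?P" using True P by simp
      then have q: "?q < p k" using nn by (simp add: nat_less_iff floor_less_iff)
      have "(\<Sum>q<p k. h (digit_perm k q) * indicator (?I q) \<omega>)
          = (\<Sum>q<p k. if q = ?q then h (digit_perm k q) else 0)"
      proof (intro sum.cong refl)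
        fix q
        have "\<omega> \<in> ?I q \<longleftrightarrow> q = ?q" unfolding mem using nn by auto
        then show "h (digit_perm k q) * indicator (?I q) \<omega> = (if q = ?q then h (digit_perm k q) else 0)"
          by (simp only: indicator_def) simp
      qed
      then show ?thesis using True q by (simp add: digit_index_def)
    next
      case False
      have "\<omega> \<notin> ?I q" if "q < p k" for q
      proof
        assume "\<omega> \<in> ?I q"
        then have "0 \<le> \<omega>" "\<omega> < (real q + 1) / ?P" using P by (auto intro: order_trans[rotated])
        moreover have "(real q + 1) / ?P \<le> 1" using that P by (simp add: divide_le_eq)
        ultimately show False using False by simp
      qed
      then show ?thesis using False by simp
    qed
  qed
  have "(\<integral>\<omega>. h (digit_index k \<omega>) \<partial>unit_measure) = (\<integral>\<omega>. indicator {0..<1} \<omega> *\<^sub>R h (digit_index k \<omega>) \<partial>lborel)"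
    by (subst integral_restrict_space) auto
  also have "\<dots> = (\<integral>\<omega>. (\<Sum>q<p k. h (digit_perm k q) * indicator (?I q) \<omega>) \<partial>lborel)"
    unfolding eq ..
  also have "\<dots> = (\<Sum>q<p k. h (digit_perm k q) * measure lborel (?I q))"
    by (subst Bochner_Integration.integral_sum) (auto simp: emeasure_lborel_Ico divide_right_mono)
  also have "\<dots> = (\<Sum>q<p k. h (digit_perm k q) / ?P)"
    using P by (intro sum.cong refl) (simp add: measure_lborel_Ico divide_right_mono add_divide_distrib)
  also have "\<dots> = (\<Sum>q<p k. h (digit_perm k q)) / ?P"
    by (simp add: sum_divide_distrib)
  also have "(\<Sum>q<p k. h (digit_perm k q)) = (\<Sum>j<p k. h j)"
    by (rule sum.reindex_bij_betw[OF bij_digit_perm])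
  finally show ?thesis .
qed

lemma digit_index_convergent:
  assumes "0 \<le> \<omega>"
  shows "convergent (\<lambda>k. translate (int (digit_index k \<omega>)) V)"
proof (rule potential_Cauchy_convergent, rule CauchyI')
  fix e :: real assume "0 < e"
  then obtain K where K: "\<forall>k\<ge>K. dist (Vk k) V < e / 2" using dist_small[of "e / 2"] by auto
  show "\<exists>K. \<forall>m\<ge>K. \<forall>n>m. dist (translate (int (digit_index m \<omega>)) V) (translate (int (digit_index n \<omega>)) V) < e"
  proof (intro exI allI impI)
    fix m n assume mn: "K \<le> m" "m < n"
    have "dist (translate (int (digit_index n \<omega>)) V) (translate (int (digit_index m \<omega>)) V) \<le> 2 * dist (Vk m) V"
      by (rule dist_cong[OF digit_index_le]) (use assms mn in auto)
    also have "\<dots> < e" using spec[OF K, of m] mn by linarith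
    finally show "dist (translate (int (digit_index m \<omega>)) V) (translate (int (digit_index n \<omega>)) V) < e"
      by (simp add: dist_commute)
  qed
qed

definition haar_point :: "real \<Rightarrow> potential" where
  "haar_point \<omega> = lim (\<lambda>k. translate (int (digit_index k \<omega>)) V)"

lemma haar_point_lim:
  "0 \<le> \<omega> \<Longrightarrow> (\<lambda>k. translate (int (digit_index k \<omega>)) V) \<longlonglongrightarrow> haar_point \<omega>"
  unfolding haar_point_def using digit_index_convergent convergent_LIMSEQ_iff by blast

lemma haar_point_in_hull: "0 \<le> \<omega> \<Longrightarrow> haar_point \<omega> \<in> potential_hull V"
  by (rule closed_sequentially[OF closed_hull _ haar_point_lim]) auto

lemma translate_digit_measurable:
  "(\<lambda>\<omega>. translate (int (digit_index k \<omega>)) V) \<in> measurable unit_measure borel"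
proof (rule measurable_restrict_space1)
  show "(\<lambda>\<omega>. translate (int (digit_index k \<omega>)) V) \<in> measurable lborel borel"
    by (rule measurable_compose[where g = "\<lambda>n. translate (int n) V" and N = "count_space UNIV"])
       (use digit_index_measurable in auto)
qed

lemma haar_point_measurable:
  "haar_point \<in> measurable unit_measure (restrict_space borel (potential_hull V))"
proof (rule measurable_restrict_space2)
  show "haar_point \<in> space unit_measure \<rightarrow> potential_hull V"
    by (auto simp: space_restrict_space haar_point_in_hull)
  show "haar_point \<in> measurable unit_measure borel"
  proof (rule borel_measurable_LIMSEQ_metric[OF translate_digit_measurable])
    fix \<omega> assume "\<omega> \<in> space unit_measure"
    then show "(\<lambda>k. translate (int (digit_index k \<omega>)) V) \<longlonglongrightarrow> haar_point \<omega>"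
      by (auto simp: space_restrict_space haar_point_lim)
  qed
qed

definition haar_measure :: "potential measure" where
  "haar_measure = distr unit_measure (restrict_space borel (potential_hull V)) haar_point"

text \<open>By \<open>integral_digit_index\<close> the average is the expectation of
  \<open>f\<close> at the k-th approximation of \<open>haar_point\<close>; dominated convergence
  gives the limit.\<close>

lemma average_tendsto_haar:
  fixes f :: "potential \<Rightarrow> real"
  assumes f: "continuous_on (potential_hull V) f"
  shows "(\<lambda>k. (\<Sum>j<p k. f (translate (int j) V)) / real (p k)) \<longlonglongrightarrow> (\<integral>W. f W \<partial>haar_measure)"
proof -
  interpret prob_space unit_measure by (rule prob_space_unit)
  obtain B where B: "\<And>W. W \<in> potential_hull V \<Longrightarrow> \<bar>f W\<bar> \<le> B" using bounded_on_hull[OF f] by blast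
  have m: "f \<in> borel_measurable (restrict_space borel (potential_hull V))"
    using f by (rule borel_measurable_continuous_on_restrict)
  have "(\<lambda>k. \<integral>\<omega>. f (translate (int (digit_index k \<omega>)) V) \<partial>unit_measure)
      \<longlonglongrightarrow> (\<integral>\<omega>. f (haar_point \<omega>) \<partial>unit_measure)"
  proof (rule integral_dominated_convergence[where w = "\<lambda>_. B"])
    show "(\<lambda>\<omega>. f (haar_point \<omega>)) \<in> borel_measurable unit_measure"
      by (rule measurable_compose[OF haar_point_measurable m])
    show "(\<lambda>\<omega>. f (translate (int (digit_index k \<omega>)) V)) \<in> borel_measurable unit_measure" for k
      by (rule measurable_compose[OF measurable_restrict_space2[OF _ translate_digit_measurable] m]) auto
    show "AE \<omega> in unit_measure. (\<lambda>k. f (translate (int (digit_index k \<omega>)) V)) \<longlonglongrightarrow> f (haar_point \<omega>)"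
      by (rule AE_I2, rule continuous_on_tendsto_compose[OF f])
         (auto simp: space_restrict_space haar_point_lim haar_point_in_hull)
  qed (use B in auto)
  moreover have "(\<integral>W. f W \<partial>haar_measure) = (\<integral>\<omega>. f (haar_point \<omega>) \<partial>unit_measure)"
    unfolding haar_measure_def by (rule integral_distr[OF haar_point_measurable m])
  ultimately show ?thesis
    using integral_digit_index[where h = "\<lambda>j. f (translate (int j) V)"] by simp
qed

lemma hull_invariant_haar: "hull_invariant V haar_measure"
  unfolding hull_invariant_def
proof (intro conjI)
  show s: "sets haar_measure = sets (restrict_space borel (potential_hull V))"
    by (simp add: haar_measure_def)
  show pr: "prob_space haar_measure"
    unfolding haar_measure_def by (rule prob_space.prob_space_distr[OF prob_space_unit haar_point_measurable])
  have tm: "translate 1 \<in> measurable haar_measure haar_measure"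
    by (rule translate_measurable_hull[OF s])
  show "distr haar_measure haar_measure (translate 1) = haar_measure"
  proof (rule finite_measure_eqI_continuous[where S = "potential_hull V"])
    show "finite_measure haar_measure" using pr by (simp add: prob_space_def)
    show "finite_measure (distr haar_measure haar_measure (translate 1))"
      using prob_space.prob_space_distr[OF pr tm] by (simp add: prob_space_def)
    fix f :: "potential \<Rightarrow> real"
    assume f: "continuous_on (potential_hull V) f"
    let ?S = "\<lambda>k. \<Sum>j<p k. f (translate (int j) V)"
    have eq: "(\<integral>x. f x \<partial>distr haar_measure haar_measure (translate 1)) = (\<integral>x. f (translate 1 x) \<partial>haar_measure)"
      by (rule integral_distr[OF tm borel_measurable_hull[OF f s]])
    have lim1: "(\<lambda>k. (\<Sum>j<p k. f (translate 1 (translate (int j) V))) / real (p k))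
        \<longlonglongrightarrow> (\<integral>x. f (translate 1 x) \<partial>haar_measure)"
      by (rule average_tendsto_haar[OF continuous_on_comp_translate[OF f]])
    \<comment> \<open>The two sums telescope to one boundary term. Division by \<open>p k\<close>
      alone need not make it small, since the periods may stay bounded; it vanishes because
      \<open>translate (int (p k)) V\<close> tends to \<open>V\<close>.\<close>
    have diff0: "(\<lambda>k. (\<Sum>j<p k. f (translate 1 (translate (int j) V))) / real (p k) - ?S k / real (p k)) \<longlonglongrightarrow> 0"
    proof (rule Lim_null_comparison)
      have shift: "(\<Sum>j<P. f (translate 1 (translate (int j) V))) - (\<Sum>j<P. f (translate (int j) V))
          = f (translate (int P) V) - f V" for P
        by (induction P) (simp_all add: add.commute)
      show "\<forall>\<^sub>F k in sequentially. norm ((\<Sum>j<p k. f (translate 1 (translate (int j) V))) / real (p k) - ?S k / real (p k))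
          \<le> \<bar>f (translate (int (p k)) V) - f V\<bar>"
      proof (intro always_eventually allI)
        fix k
        have "norm ((\<Sum>j<p k. f (translate 1 (translate (int j) V))) / real (p k) - ?S k / real (p k))
          = \<bar>f (translate (int (p k)) V) - f V\<bar> / real (p k)"
          unfolding diff_divide_distrib[symmetric] shift by simp
        also have "\<dots> \<le> \<bar>f (translate (int (p k)) V) - f V\<bar> / 1"
          using pos[of k] by (intro divide_left_mono) (auto simp: Suc_le_eq)
        finally show "norm ((\<Sum>j<p k. f (translate 1 (translate (int j) V))) / real (p k) - ?S k / real (p k))
          \<le> \<bar>f (translate (int (p k)) V) - f V\<bar>" by simp
      qed
      have "(\<lambda>k. dist (translate (int (p k)) V) V) \<longlonglongrightarrow> 0"
      proof (rule Lim_null_comparison)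
        have "dist (translate (int (p k)) V) (translate 0 V) \<le> 2 * dist (Vk k) V" for k
          by (rule dist_cong) simp
        then show "\<forall>\<^sub>F k in sequentially. norm (dist (translate (int (p k)) V) V) \<le> 2 * dist (Vk k) V"
          by simp
        show "(\<lambda>k. 2 * dist (Vk k) V) \<longlonglongrightarrow> 0"
          using tendsto_mult_right_zero[OF dist_0] by blast
      qed
      then have lim: "(\<lambda>k. translate (int (p k)) V) \<longlonglongrightarrow> V"
        by (rule tendsto_dist_iff[THEN iffD2])
      have "V \<in> potential_hull V" using translate_in_hull[of 0 V] by simp
      then have "(\<lambda>k. f (translate (int (p k)) V)) \<longlonglongrightarrow> f V"
        by (intro continuous_on_tendsto_compose[OF f lim]) auto
      then show "(\<lambda>k. \<bar>f (translate (int (p k)) V) - f V\<bar>) \<longlonglongrightarrow> 0"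
        by (intro tendsto_rabs_zero) (simp add: LIM_zero)
    qed
    show "(\<integral>x. f x \<partial>distr haar_measure haar_measure (translate 1)) = (\<integral>x. f x \<partial>haar_measure)"
      using LIMSEQ_unique[OF Lim_transform2[OF lim1 diff0] average_tendsto_haar[OF f]] eq by simp
  qed (use s in simp_all)
qed

text \<open>Unique existence is what gives the definite description its defining property.\<close>

lemma hull_invariant_hull_measure: "hull_invariant V (hull_measure V)"
proof -
  have "\<exists>!\<mu>. hull_invariant V \<mu>"
    using hull_invariant_haar hull_invariant_unique by blast
  from theI'[OF this] show ?thesis
    unfolding hull_measure_def hull_invariant_def .
qed

end

section \<open>The Lyapunov exponent as a limit of averages\<close>

text \<open>Fekete's lemma; nonnegativity keeps the infimum finite.\<close>

lemma subadditive_quotient_convergent: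
  fixes a :: "nat \<Rightarrow> real"
  assumes sub: "\<And>m n. a (m + n) \<le> a m + a n" and nonneg: "\<And>n. 0 \<le> a n"
  obtains l where "(\<lambda>n. a n / real n) \<longlonglongrightarrow> l" "\<And>n. 0 < n \<Longrightarrow> l \<le> a n / real n"
proof -
  define l where "l = (INF n\<in>{0<..}. a n / real n)"
  have bdd: "bdd_below ((\<lambda>n. a n / real n) ` {0<..})"
    by (rule bdd_belowI2[where m = 0]) (simp add: nonneg)
  have le: "l \<le> a n / real n" if "0 < n" for n
    unfolding l_def by (rule cINF_lower[OF bdd]) (use that in simp)
  have mult: "a (q * m + r) \<le> real q * a m + a r" for q m r
  proof (induction q)
    case (Suc q)
    have "a (Suc q * m + r) \<le> a m + a (q * m + r)" using sub[of m "q * m + r"] by (simp add: add.assoc)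
    then show ?case using Suc by (simp add: algebra_simps)
  qed simp
  have "(\<lambda>n. a n / real n) \<longlonglongrightarrow> l"
  proof (rule LIMSEQ_I)
    fix e :: real assume e: "0 < e"
    have "\<exists>m\<in>{0<..}. a m / real m < l + e / 2"
      using cINF_less_iff[OF _ bdd, of "l + e / 2"] e by (simp add: l_def[symmetric])
    then obtain m where m: "0 < m" "a m / real m < l + e / 2" by auto
    define R where "R = (\<Sum>r<m. a r)"
    have R: "a r \<le> R" if "r < m" for r
      unfolding R_def by (rule member_le_sum) (use that nonneg in auto)
    have R0: "0 \<le> R" unfolding R_def by (simp add: sum_nonneg nonneg)
    obtain N :: nat where N: "2 * R / e < real N" using reals_Archimedean2 by blast
    have "norm (a n / real n - l) < e" if n: "Suc N \<le> n" for n
    proof -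
      have "a n = a (n div m * m + n mod m)" by simp
      also have "\<dots> \<le> real (n div m) * a m + R"
        using mult[of "n div m" m "n mod m"] R[of "n mod m"] m(1) by simp
      finally have "a n / real n \<le> (real (n div m) * a m + R) / real n" by (rule divide_right_mono) simp
      also have "\<dots> = (real (n div m) * real m / real n) * (a m / real m) + R / real n"
        using m(1) by (simp add: add_divide_distrib)
      also have "\<dots> \<le> 1 * (a m / real m) + R / real n"
      proof (intro add_mono mult_right_mono order_refl)
        have "real (n div m * m) \<le> real n" by (subst of_nat_le_iff) (rule div_times_less_eq_dividend)
        then show "real (n div m) * real m / real n \<le> 1" by (simp add: divide_le_eq)
      qed (simp add: nonneg)
      also have "R / real n < e / 2"
      proof -
        have "2 * R / e < real n" using N n by linarith
        then show ?thesis using e n by (simp add: field_simps)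
      qed
      finally have "a n / real n < l + e" using m(2) by linarith
      moreover have "l \<le> a n / real n" using le n by simp
      ultimately show ?thesis by simp
    qed
    then show "\<exists>N. \<forall>n\<ge>N. norm (a n / real n - l) < e" by blast
  qed
  then show ?thesis using that le by blast
qed

section \<open>Log norms of the cocycle and their means over the hull\<close>

definition log_norm :: "nat \<Rightarrow> real \<Rightarrow> potential \<Rightarrow> real" where
  "log_norm N E W = ln (op_norm (transfer_matrix N E W))"

lemma log_norm_nonneg [simp]: "0 \<le> log_norm N E W"
  by (simp add: log_norm_def)

lemma log_norm_0 [simp]: "log_norm 0 E W = 0"
proof -
  have "op_norm (mat 1) = 1" using op_norm_mat_1 op_norm_transfer_ge_1[of 0 E W] by simp
  then show ?thesis by (simp add: log_norm_def)
qed

lemma log_norm_add: "log_norm (m + n) E W \<le> log_norm m E (translate (- int n) W) + log_norm n E W"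
proof -
  have "op_norm (transfer_matrix (m + n) E W)
      \<le> op_norm (transfer_matrix m E (translate (- int n) W)) * op_norm (transfer_matrix n E W)"
  proof -
    have "apply_bcontfun (translate (- int n) W) = (\<lambda>i. W (i + int n))" by (rule ext) simp
    then show ?thesis by (simp add: transfer_matrix_add op_norm_mult)
  qed
  then have "ln (op_norm (transfer_matrix (m + n) E W))
      \<le> ln (op_norm (transfer_matrix m E (translate (- int n) W)) * op_norm (transfer_matrix n E W))"
    using op_norm_transfer_ge_1[of "m + n" E W] by (intro ln_mono) linarith+
  also have "\<dots> = log_norm m E (translate (- int n) W) + log_norm n E W"
    using op_norm_transfer_ge_1[of m E "translate (- int n) W"] op_norm_transfer_ge_1[of n E W]
    unfolding log_norm_def by (intro ln_mult_pos) linarith+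
  finally show ?thesis by (simp add: log_norm_def)
qed

lemma log_norm_diff:
  assumes "\<bar>E\<bar> + norm W \<le> B" "\<bar>E'\<bar> + norm W' \<le> B"
  shows "\<bar>log_norm N E W - log_norm N E' W'\<bar> \<le> real N * (1 + B) ^ N * (\<bar>E - E'\<bar> + dist W W')"
proof -
  have bound: "\<bar>E - W x\<bar> \<le> B" if "\<bar>E\<bar> + norm W \<le> B" for x E and W :: potential
    using that norm_bounded[of W x] by simp
  have B: "0 \<le> B" using assms(1) norm_ge_zero[of W] by linarith
  have close: "\<bar>(E - W x) - (E' - W' x)\<bar> \<le> \<bar>E - E'\<bar> + dist W W'"
    for x E E' and W W' :: potential
    using dist_bounded[of W x W'] by (simp add: dist_real_def)
  have "log_norm N E W \<le> log_norm N E' W' + real N * (1 + B) ^ N * (\<bar>E - E'\<bar> + dist W W')"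
    unfolding log_norm_def by (rule ln_op_norm_transfer_diff) (intro B bound assms close add_nonneg_nonneg; simp)+
  moreover have "log_norm N E' W' \<le> log_norm N E W + real N * (1 + B) ^ N * (\<bar>E' - E\<bar> + dist W' W)"
    unfolding log_norm_def by (rule ln_op_norm_transfer_diff) (intro B bound assms close add_nonneg_nonneg; simp)+
  ultimately show ?thesis by (simp add: dist_commute abs_minus_commute abs_le_iff)
qed

lemma continuous_on_log_norm: "continuous_on (potential_hull V) (log_norm N E)"
proof (rule lipschitz_on_continuous_on)
  show "(real N * (1 + (\<bar>E\<bar> + norm V)) ^ N)-lipschitz_on (potential_hull V) (log_norm N E)"
    by (rule lipschitz_onI)
       (use log_norm_diff[of E _ "\<bar>E\<bar> + norm V" E _ N] norm_hull_le[of _ V] in \<open>auto simp: dist_real_def\<close>)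
qed

context limit_periodic_chain
begin

definition mean_log_norm :: "nat \<Rightarrow> real \<Rightarrow> real" where
  "mean_log_norm N E = (\<integral>W. log_norm N E W \<partial>hull_measure V)"

lemma mean_log_norm_lim:
  "(\<lambda>k. (\<Sum>j<p k. log_norm N E (translate (int j) V)) / real (p k)) \<longlonglongrightarrow> mean_log_norm N E"
  unfolding mean_log_norm_def
  by (rule average_tendsto_integral[OF hull_invariant_hull_measure continuous_on_log_norm])

lemma mean_log_norm_subadditive: "mean_log_norm (m + n) E \<le> mean_log_norm m E + mean_log_norm n E"
proof -
  let ?\<mu> = "hull_measure V"
  have s: "sets ?\<mu> = sets (restrict_space borel (potential_hull V))" and fin: "finite_measure ?\<mu>"
    using hull_invariant_hull_measure by (auto simp: hull_invariant_def prob_space_def)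
  note cont = continuous_on_log_norm[of V _ E] continuous_on_comp_translate[OF continuous_on_log_norm]
  have int: "integrable ?\<mu> (log_norm k E)" "integrable ?\<mu> (\<lambda>W. log_norm m E (translate (- int n) W))" for k
    by (intro integrable_hull[OF _ fin s] cont)+
  have "mean_log_norm (m + n) E \<le> (\<integral>W. log_norm m E (translate (- int n) W) + log_norm n E W \<partial>?\<mu>)"
    unfolding mean_log_norm_def
    by (intro integral_mono Bochner_Integration.integrable_add int log_norm_add)
  also have "\<dots> = (\<integral>W. log_norm m E (translate (- int n) W) \<partial>?\<mu>) + mean_log_norm n E"
    unfolding mean_log_norm_def by (intro Bochner_Integration.integral_add int)
  \<comment> \<open>Invariance was iterated only for nonnegative shifts, so the shift by
    \<open>- int n\<close> is removed by inserting \<open>translate (int n)\<close>.\<close>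
  also have "(\<integral>W. log_norm m E (translate (- int n) W) \<partial>?\<mu>)
      = (\<integral>W. log_norm m E (translate (- int n) (translate (int n) W)) \<partial>?\<mu>)"
    by (rule integral_translate[OF hull_invariant_hull_measure cont(2), symmetric])
  also have "\<dots> = mean_log_norm m E"
    by (simp add: mean_log_norm_def)
  finally show ?thesis .
qed

lemma mean_log_norm_nonneg: "0 \<le> mean_log_norm n E"
  unfolding mean_log_norm_def by (rule Bochner_Integration.integral_nonneg) simp

text \<open>Subadditivity shows that \<open>lim\<close> in the definition is a genuine limit, and
  that it is also the infimum, so an estimate at a single length bounds the exponent from
  above.\<close>

lemma lyapunov_lim:
  shows "(\<lambda>n. mean_log_norm n E / real n) \<longlonglongrightarrow> lyapunov_exponent V E"
    and "0 < n \<Longrightarrow> lyapunov_exponent V E \<le> mean_log_norm n E / real n"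
proof -
  obtain l where l: "(\<lambda>n. mean_log_norm n E / real n) \<longlonglongrightarrow> l"
    "\<And>n. 0 < n \<Longrightarrow> l \<le> mean_log_norm n E / real n"
    using subadditive_quotient_convergent[of "\<lambda>n. mean_log_norm n E"]
      mean_log_norm_subadditive mean_log_norm_nonneg by blast
  have "lyapunov_exponent V E = lim (\<lambda>n. mean_log_norm n E / real n)"
    by (simp add: lyapunov_exponent_def mean_log_norm_def log_norm_def op_norm_def)
  then have "lyapunov_exponent V E = l" using limI[OF l(1)] by simp
  then show "(\<lambda>n. mean_log_norm n E / real n) \<longlonglongrightarrow> lyapunov_exponent V E"
    "0 < n \<Longrightarrow> lyapunov_exponent V E \<le> mean_log_norm n E / real n"
    using l by auto
qed

lemma lyapunov_le:
  assumes "0 < n" "\<And>j. log_norm n E (translate (int j) V) \<le> b * real n"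
  shows "lyapunov_exponent V E \<le> b"
proof -
  have "mean_log_norm n E \<le> b * real n"
  proof (rule LIMSEQ_le_const2[OF mean_log_norm_lim], intro exI allI impI)
    fix k
    have "(\<Sum>j<p k. log_norm n E (translate (int j) V)) \<le> (\<Sum>j<p k. b * real n)"
      by (intro sum_mono assms)
    then show "(\<Sum>j<p k. log_norm n E (translate (int j) V)) / real (p k) \<le> b * real n"
      using pos[of k] by (simp add: divide_le_eq mult.commute)
  qed
  then have "mean_log_norm n E / real n \<le> b" using assms(1) by (simp add: divide_le_eq)
  then show ?thesis using lyapunov_lim(2)[OF assms(1), of E] by linarith
qed

text \<open>Upper semicontinuity at finite length: for fixed \<open>N\<close> the log norms are
  Lipschitz in energy and potential on bounded sets, so the lower bound survives the limit in
  \<open>k\<close>; \<open>N\<close> tends to infinity only afterwards. This is why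
  \<open>lower\<close> is required at every \<open>N\<close>.\<close>

lemma lyapunov_ge:
  assumes e: "e \<longlonglongrightarrow> E"
    and lower: "\<And>k N. c * real N * real (p k) \<le> (\<Sum>j<p k. log_norm N (e k) (translate (int j) (Vk k)))"
  shows "c \<le> lyapunov_exponent V E"
proof -
  have mean: "c * real N \<le> mean_log_norm N E" for N
  proof -
    obtain Be where Be: "\<And>k. \<bar>e k\<bar> \<le> Be"
      using convergent_imp_bounded[OF e] by (auto simp: bounded_iff)
    obtain Bv where Bv: "\<And>k. norm (Vk k) \<le> Bv"
      using convergent_imp_bounded[OF conv] by (auto simp: bounded_iff)
    define B where "B = max (Be + Bv) (\<bar>E\<bar> + norm V)"
    define h where "h k = real N * (1 + B) ^ N * (\<bar>e k - E\<bar> + dist (Vk k) V)" for k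
    have norm_le: "norm (translate m W) \<le> norm W" for m W
      by (rule norm_bound) (use norm_bounded[of W] in simp)
    have diff: "log_norm N (e k) (translate (int j) (Vk k)) \<le> log_norm N E (translate (int j) V) + h k" for j k
    proof -
      have "\<bar>e k\<bar> + norm (translate (int j) (Vk k)) \<le> B" "\<bar>E\<bar> + norm (translate (int j) V) \<le> B"
        using Be[of k] Bv[of k] norm_le[of "int j" "Vk k"] norm_le[of "int j" V] unfolding B_def by linarith+
      from log_norm_diff[OF this, of N] show ?thesis by (simp add: h_def abs_le_iff)
    qed
    have "c * real N - h k \<le> (\<Sum>j<p k. log_norm N E (translate (int j) V)) / real (p k)" for k
    proof -
      have "c * real N * real (p k) \<le> (\<Sum>j<p k. log_norm N E (translate (int j) V) + h k)"
        by (rule order_trans[OF lower[of N k] sum_mono]) (rule diff)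
      then show ?thesis using pos[of k] by (simp add: sum.distrib field_simps)
    qed
    moreover have "(\<lambda>k. c * real N - h k) \<longlonglongrightarrow> c * real N - real N * (1 + B) ^ N * (0 + 0)"
      unfolding h_def using e by (intro tendsto_intros dist_0 tendsto_rabs_zero) (simp add: LIM_zero)
    ultimately show ?thesis
      using LIMSEQ_le[OF _ mean_log_norm_lim[of N E], of "\<lambda>k. c * real N - h k"] by auto
  qed
  show ?thesis
  proof (rule LIMSEQ_le_const[OF lyapunov_lim(1)], intro exI allI impI)
    fix n :: nat assume "1 \<le> n"
    then show "c \<le> mean_log_norm n E / real n"
      using mean[of n] by (simp add: le_divide_eq)
  qed
qed

end

section \<open>Periodic potentials and impurities\<close>

lemma periodic_apply:
  assumes "translate (int p) V = V"
  shows "V (i + int p * q) = V i"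
  using arg_cong[OF translate_mult_period[OF assms, of "- q"], of "\<lambda>W. apply_bcontfun W i"] by simp

lemma periodic_shift:
  assumes "translate (int p) V = V"
  shows "(\<lambda>i. V (i + int (q * p))) = apply_bcontfun V"
proof
  fix i
  show "V (i + int (q * p)) = V i"
    using periodic_apply[OF assms, of i "int q"] by (simp add: mult.commute)
qed

lemma trace_2: "trace A = A $ 1 $ 1 + A $ 2 $ 2" for A :: "'a::comm_semiring_1^2^2"
  by (simp add: trace_def sum_2)

lemma matrix_mult_2: "(A ** B) $ i $ j = A $ i $ 1 * B $ 1 $ j + A $ i $ 2 * B $ 2 $ j"
  for A B :: "real^2^2"
  by (simp add: matrix_matrix_mult_def sum_2)

lemma cayley_hamilton_det_1:
  fixes A :: "real^2^2"
  assumes "det A = 1"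
  shows "A ** A = trace A *\<^sub>R A - mat 1"
  using assms by (auto simp: vec_eq_iff forall_2 matrix_mult_2 trace_2 det_2 mat_def algebra_simps)

text \<open>\<open>cheb t n\<close> is the Chebyshev polynomial of the second kind of degree n - 1
  at t / 2. These are the coefficients in the powers of a matrix of determinant 1 and trace
  \<open>t\<close>.\<close>

fun cheb :: "real \<Rightarrow> nat \<Rightarrow> real" where
  "cheb t 0 = 0"
| "cheb t (Suc 0) = 1"
| "cheb t (Suc (Suc n)) = t * cheb t (Suc n) - cheb t n"

lemma transfer_matrix_period_power:
  fixes V :: potential and E :: real
  assumes "translate (int p) V = V"
  defines "A \<equiv> transfer_matrix p E V"
  shows "transfer_matrix (Suc n * p) E V = cheb (trace A) (Suc n) *\<^sub>R A - cheb (trace A) n *\<^sub>R mat 1"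
proof (induction n)
  case 0
  show ?case by (simp add: A_def)
next
  case (Suc n)
  have "transfer_matrix (Suc (Suc n) * p) E V = A ** transfer_matrix (Suc n * p) E V"
    using transfer_matrix_add[of p "Suc n * p" E V] periodic_shift[OF assms(1), of "Suc n"]
    by (simp only: A_def mult_Suc[of "Suc n"])
  also have "\<dots> = cheb (trace A) (Suc n) *\<^sub>R (A ** A) - cheb (trace A) n *\<^sub>R A"
    unfolding Suc by (simp add: vec_eq_iff forall_2 matrix_mult_2 mat_def algebra_simps)
  also have "A ** A = trace A *\<^sub>R A - mat 1"
    by (rule cayley_hamilton_det_1) (simp add: A_def)
  finally show ?case by (simp add: algebra_simps)
qed

text \<open>Both sides obey the same recursion, whose characteristic roots are \<open>l\<close> and
  \<open>m\<close>. The second left-hand side is the trace of the power n + 1 of a matrix with these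
  eigenvalues.\<close>

lemma cheb_eigenvalue:
  assumes "l * m = 1" "l + m = t"
  shows "cheb t n * (l - m) = l ^ n - m ^ n"
    and "t * cheb t (Suc n) - 2 * cheb t n = l ^ Suc n + m ^ Suc n"
proof -
  \<comment> \<open>The sign \<open>s = -1\<close> serves the difference of powers and
    \<open>s = 1\<close> their sum.\<close>
  have step: "t * (l ^ Suc n + s * m ^ Suc n) - (l ^ n + s * m ^ n) = l ^ Suc (Suc n) + s * m ^ Suc (Suc n)"
    for n s
  proof -
    have "(l + m) * (l ^ Suc n + s * m ^ Suc n) - (l ^ n + s * m ^ n)
        = l ^ Suc (Suc n) + s * m ^ Suc (Suc n) + (l * m - 1) * (l ^ n + s * m ^ n)"
      by (simp add: algebra_simps)
    then show ?thesis using assms by simp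
  qed
  have "cheb t n * (l - m) = l ^ n - m ^ n \<and> cheb t (Suc n) * (l - m) = l ^ Suc n - m ^ Suc n"
  proof (induction n)
    case (Suc n)
    have "cheb t (Suc (Suc n)) * (l - m) = t * (cheb t (Suc n) * (l - m)) - cheb t n * (l - m)"
      by (simp add: algebra_simps)
    also have "\<dots> = t * (l ^ Suc n - m ^ Suc n) - (l ^ n - m ^ n)"
      using Suc by simp
    also have "\<dots> = l ^ Suc (Suc n) - m ^ Suc (Suc n)"
      using step[of n "-1"] by simp
    finally show ?case using Suc by simp
  qed simp
  then show "cheb t n * (l - m) = l ^ n - m ^ n" by simp
  define w where "w n = t * cheb t (Suc n) - 2 * cheb t n" for n
  have w_rec: "w (Suc (Suc n)) = t * w (Suc n) - w n" for n
    by (simp add: w_def algebra_simps)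
  have "w n = l ^ Suc n + m ^ Suc n \<and> w (Suc n) = l ^ Suc (Suc n) + m ^ Suc (Suc n)"
  proof (induction n)
    case 0
    have "w 0 = l + m" using assms by (simp add: w_def)
    moreover have "w (Suc 0) = t * (l + m) - 2" using assms by (simp add: w_def)
    moreover have "t * (l + m) - 2 = l * l + m * m"
      using step[of 0 1] by simp
    ultimately show ?case by simp
  next
    case (Suc n)
    then show ?case using step[of "Suc n" 1] by (simp add: w_rec)
  qed
  then show "t * cheb t (Suc n) - 2 * cheb t n = l ^ Suc n + m ^ Suc n"
    by (simp add: w_def)
qed

text \<open>The left-hand side is the determinant of the power n + 1, expressed in its two
  coefficients.\<close>

lemma cheb_invariant: "cheb t (Suc n) ^ 2 - t * cheb t (Suc n) * cheb t n + cheb t n ^ 2 = 1"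
  by (induction n) (auto simp: power2_eq_square algebra_simps)

text \<open>For |t| < 2 the quadratic form of \<open>cheb_invariant\<close> is positive definite, so
  its level set is bounded; completing the square makes this explicit.\<close>

lemma cheb_bounded:
  assumes "\<bar>t\<bar> < 2"
  obtains K where "\<And>n. \<bar>cheb t n\<bar> \<le> K"
proof
  fix n
  have "t\<^sup>2 < 2\<^sup>2" using assms abs_less_iff power2_strict_mono[of t 2] by auto
  then have pos: "0 < 1 - t\<^sup>2 / 4" by simp
  have "(1 - t\<^sup>2 / 4) * cheb t n ^ 2 + (cheb t (Suc n) - t / 2 * cheb t n) ^ 2
      = cheb t (Suc n) ^ 2 - t * cheb t (Suc n) * cheb t n + cheb t n ^ 2"
    by (simp add: power2_eq_square algebra_simps)
  then have "(1 - t\<^sup>2 / 4) * cheb t n ^ 2 \<le> 1"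
    using zero_le_power2[of "cheb t (Suc n) - t / 2 * cheb t n"] unfolding cheb_invariant by linarith
  then have "cheb t n ^ 2 \<le> 1 / (1 - t\<^sup>2 / 4)" using pos by (simp add: field_simps)
  then have "sqrt (cheb t n ^ 2) \<le> sqrt (1 / (1 - t\<^sup>2 / 4))" by (rule real_sqrt_le_mono)
  then show "\<bar>cheb t n\<bar> \<le> sqrt (1 / (1 - t\<^sup>2 / 4))" by simp
qed

text \<open>Whole periods are controlled by \<open>cheb_bounded\<close>, the remainder by finitely
  many matrices. A block starting at residue \<open>r\<close> is the block of length
  \<open>m + r\<close> from 0 times the inverse of the initial block, so the finitely many inverses
  bound the effect of the starting site.\<close>

lemma elliptic_bounded:
  fixes V :: potential
  assumes per: "translate (int p) V = V" and p: "0 < p"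
    and ell: "\<bar>trace (transfer_matrix p E V)\<bar> < 2"
  obtains C where "\<And>m i. op_norm (transfer_matrix m E (\<lambda>x. V (x + i))) \<le> C"
proof -
  define A where "A = transfer_matrix p E V"
  obtain K where K: "\<And>n. \<bar>cheb (trace A) n\<bar> \<le> K"
    using cheb_bounded[OF ell] unfolding A_def by blast
  have K0: "0 \<le> K" using K[of 0] by simp
  define D where "D = 1 + K * op_norm A + K"
  have D: "op_norm (transfer_matrix (q * p) E V) \<le> D" for q
  proof (cases q)
    case 0
    then show ?thesis using op_norm_mat_1 K0 by (simp add: D_def add_nonneg_nonneg add_increasing2)
  next
    case (Suc n)
    have "op_norm (transfer_matrix (q * p) E V)
        \<le> \<bar>cheb (trace A) (Suc n)\<bar> * op_norm A + \<bar>cheb (trace A) n\<bar> * op_norm (mat 1)"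
      unfolding Suc transfer_matrix_period_power[OF per] A_def
      by (intro order_trans[OF op_norm_diff] add_mono op_norm_scaleR)
    also have "\<dots> \<le> K * op_norm A + K * 1"
      by (intro add_mono mult_mono K op_norm_mat_1 K0) auto
    finally show ?thesis by (simp add: D_def)
  qed
  define R where "R = (\<Sum>r<p. op_norm (transfer_matrix r E V))"
  have "\<exists>B. transfer_matrix r E V ** B = mat 1" for r
    using invertible_det_nz[of "transfer_matrix r E V"] unfolding invertible_def by auto
  then obtain Inv where Inv: "\<And>r. transfer_matrix r E V ** Inv r = mat 1" by metis
  define I where "I = (\<Sum>r<p. op_norm (Inv r))"
  have R0: "0 \<le> R" unfolding R_def by (rule sum_nonneg) simp
  have D0: "0 \<le> D" using K0 by (simp add: D_def)
  have whole: "op_norm (transfer_matrix l E V) \<le> R * D" for l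
  proof -
    define q r where "q = l div p" and "r = l mod p"
    have "l = r + q * p" by (simp add: q_def r_def)
    then have "transfer_matrix l E V = transfer_matrix r E V ** transfer_matrix (q * p) E V"
      using transfer_matrix_add[of r "q * p" E V] periodic_shift[OF per, of q] by (simp only:)
    moreover have "op_norm (transfer_matrix r E V) \<le> R"
      unfolding R_def by (rule member_le_sum) (use p in \<open>auto simp: r_def\<close>)
    ultimately show ?thesis
      using order_trans[OF op_norm_mult mult_mono[OF _ D]] R0 by simp
  qed
  have "op_norm (transfer_matrix m E (\<lambda>x. V (x + i))) \<le> R * D * I" for m i
  proof -
    define r where "r = nat (i mod int p)"
    have r: "r < p" "int r = i mod int p" using p by (auto simp: r_def nat_less_iff)
    have "V (x + i) = V (x + int r)" for x
    proof -
      have "x + i = x + int r + int p * (i div int p)"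
        by (simp add: r(2))
      then show ?thesis using periodic_apply[OF per] by metis
    qed
    then have shift: "(\<lambda>x. V (x + i)) = (\<lambda>x. V (x + int r))" by blast
    let ?B = "transfer_matrix r E V"
    have "transfer_matrix m E (\<lambda>x. V (x + i)) = transfer_matrix (m + r) E V ** Inv r"
      by (simp add: shift transfer_matrix_add matrix_mul_assoc[symmetric] Inv)
    then have "op_norm (transfer_matrix m E (\<lambda>x. V (x + i))) \<le> op_norm (transfer_matrix (m + r) E V) * op_norm (Inv r)"
      by (simp add: op_norm_mult)
    also have "\<dots> \<le> R * D * I"
    proof (intro mult_mono whole)
      show "op_norm (Inv r) \<le> I"
        unfolding I_def by (rule member_le_sum) (use r in auto)
    qed (use R0 D0 in auto)
    finally show ?thesis .
  qed
  then show ?thesis using that by blast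
qed

section \<open>Periodic impurities\<close>

lemma impurity_bcontfun: "(\<lambda>i::int. if int M dvd i + 1 then 1 else 0 :: real) \<in> bcontfun"
  by (rule bcontfun_normI[where b = 1]) auto

text \<open>The impurities sit at the sites congruent to -1 modulo \<open>M\<close>, the last site
  of each block starting at a multiple of \<open>M\<close>, so that over one block only the leftmost
  factor changes.\<close>

definition impurity :: "nat \<Rightarrow> potential" where
  "impurity M = Bcontfun (\<lambda>i. if int M dvd i + 1 then 1 else 0)"

lemma apply_impurity [simp]: "impurity M i = (if int M dvd i + 1 then 1 else 0)"
  using impurity_bcontfun[of M] by (simp add: impurity_def Bcontfun_inverse)

lemma apply_add_impurity [simp]:
  "apply_bcontfun (V + d *\<^sub>R impurity M) i = V i + (if int M dvd i + 1 then d else 0)"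
  by (simp add: plus_bcontfun.rep_eq scaleR_bcontfun.rep_eq)

lemma norm_impurity_le: "norm (d *\<^sub>R impurity M) \<le> \<bar>d\<bar>"
  by (rule norm_bound) (simp add: scaleR_bcontfun.rep_eq)

lemma translate_add_impurity:
  assumes "translate (int p) V = V" "p dvd M"
  shows "translate (int M) (V + d *\<^sub>R impurity M) = V + d *\<^sub>R impurity M"
proof (rule bcontfun_eqI)
  fix i
  obtain q where q: "M = p * q" using assms(2) by blast
  have "V (i - int M) = V i" using periodic_apply[OF assms(1), of i "- int q"] by (simp add: q)
  moreover have "int M dvd (i + 1) - int M \<longleftrightarrow> int M dvd i + 1"
    by (rule dvd_diff_left_iff) simp
  then have "int M dvd i - int M + 1 \<longleftrightarrow> int M dvd i + 1"
    by (simp only: diff_add_eq)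
  ultimately show "translate (int M) (V + d *\<^sub>R impurity M) i = (V + d *\<^sub>R impurity M) i"
    by simp
qed

text \<open>The impurity subtracts \<open>d\<close> times the second row from the first row of the
  block matrix, because it acts as a shear on the left.\<close>

lemma transfer_matrix_impurity:
  fixes V :: potential and E d :: real
  assumes "0 < M"
  defines "A \<equiv> transfer_matrix M E V" and "B \<equiv> transfer_matrix M E (V + d *\<^sub>R impurity M)"
  shows "trace B = trace A - d * A $ 2 $ 1" and "B $ 2 $ 1 = A $ 2 $ 1"
proof -
  obtain m where m: "M = Suc m" using assms(1) by (cases M) auto
  have nd: "\<not> int M dvd int x + 1" if "x < m" for x
    using that m zdvd_not_zless[of "int x + 1" "int M"] by simp
  let ?R = "transfer_matrix m E V"
  have "transfer_matrix m E (V + d *\<^sub>R impurity M) = ?R"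
    by (rule transfer_matrix_cong) (simp add: nd)
  moreover have "(V + d *\<^sub>R impurity M) (int m) = V (int m) + d"
    by (simp add: m add.commute)
  moreover have "B = transfer_matrix (Suc m) E (V + d *\<^sub>R impurity M)"
    by (simp only: B_def m)
  ultimately have B: "B = one_step_matrix E (V (int m) + d) ** ?R"
    by (simp only: transfer_matrix_Suc)
  have A: "A = one_step_matrix E (V (int m)) ** ?R"
    by (simp add: A_def m transfer_matrix_Suc)
  show "trace B = trace A - d * A $ 2 $ 1" "B $ 2 $ 1 = A $ 2 $ 1"
    unfolding A B by (simp_all add: trace_2 matrix_mult_2 one_step_matrix_nth algebra_simps)
qed

section \<open>Critical impurity strengths\<close>

text \<open>For |t| > 2 the sign makes \<open>dominant t\<close> the eigenvalue of larger modulus of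
  a matrix with determinant 1 and trace \<open>t\<close>; \<open>eigen_gap t\<close> is this
  eigenvalue minus its inverse.\<close>

definition eigen_gap :: "real \<Rightarrow> real" where
  "eigen_gap t = sgn t * sqrt (t\<^sup>2 - 4)"

definition dominant :: "real \<Rightarrow> real" where
  "dominant t = (t + eigen_gap t) / 2"

lemma four_less_square:
  fixes t :: real
  assumes "2 < \<bar>t\<bar>"
  shows "4 < t\<^sup>2"
  using power_strict_mono[of 2 "\<bar>t\<bar>" 2] assms by simp

lemma eigen_gap_square:
  assumes "2 < \<bar>t\<bar>"
  shows "(eigen_gap t)\<^sup>2 = t\<^sup>2 - 4"
  using four_less_square[OF assms] assms by (auto simp: eigen_gap_def power_mult_distrib sgn_if)

lemma eigen_gap_nonzero:
  assumes "2 < \<bar>t\<bar>"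
  shows "eigen_gap t \<noteq> 0"
  using eigen_gap_square[OF assms] four_less_square[OF assms] by auto

lemma abs_eigen_gap_le:
  assumes "2 < \<bar>t\<bar>"
  shows "\<bar>eigen_gap t\<bar> \<le> \<bar>t\<bar>"
  unfolding abs_le_square_iff eigen_gap_square[OF assms] by simp

lemma dominant_inverse:
  assumes "2 < \<bar>t\<bar>"
  defines "m \<equiv> dominant t - eigen_gap t"
  shows "dominant t * m = 1" "dominant t + m = t"
proof -
  have "dominant t * m = (t\<^sup>2 - (eigen_gap t)\<^sup>2) / 4"
    by (simp add: m_def dominant_def field_simps power2_eq_square)
  then show "dominant t * m = 1" by (simp add: eigen_gap_square[OF assms(1)])
  show "dominant t + m = t" by (simp add: m_def dominant_def field_simps)
qed

lemma abs_dominant: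
  assumes "2 < \<bar>t\<bar>"
  shows "\<bar>t\<bar> / 2 \<le> \<bar>dominant t\<bar>" "1 < \<bar>dominant t\<bar>"
proof -
  have s: "0 \<le> sqrt (t\<^sup>2 - 4)" using four_less_square[OF assms] by simp
  show "\<bar>t\<bar> / 2 \<le> \<bar>dominant t\<bar>"
  proof (cases "0 < t")
    case True
    with s show ?thesis by (simp add: dominant_def eigen_gap_def)
  next
    case False
    with assms have "t < 0" by simp
    then have "dominant t = (t - sqrt (t\<^sup>2 - 4)) / 2" by (simp add: dominant_def eigen_gap_def)
    then have "- dominant t = - t / 2 + sqrt (t\<^sup>2 - 4) / 2" by (simp add: field_simps)
    then have "- t / 2 \<le> - dominant t" using s by simp
    then show ?thesis using \<open>t < 0\<close> by simp
  qed
  then show "1 < \<bar>dominant t\<bar>" using assms by simp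
qed

lemma tendsto_eigen_gap:
  assumes "(f \<longlongrightarrow> t) F" "2 < \<bar>t\<bar>"
  shows "((\<lambda>x. eigen_gap (f x)) \<longlongrightarrow> eigen_gap t) F"
  unfolding eigen_gap_def using assms by (intro tendsto_intros) auto

lemma tendsto_dominant:
  assumes "(f \<longlongrightarrow> t) F" "2 < \<bar>t\<bar>"
  shows "((\<lambda>x. dominant (f x)) \<longlongrightarrow> dominant t) F"
  unfolding dominant_def using assms by (intro tendsto_intros tendsto_eigen_gap) auto

lemma eigenvector_exists:
  fixes A :: "real^2^2"
  assumes det: "det A = 1" and l: "l * m = 1" "l + m = trace A" "1 < \<bar>l\<bar>"
  obtains v where "v \<noteq> 0" "A *v v = l *\<^sub>R v"
proof -
  have x: "A $ 1 $ 1 = l + m - A $ 2 $ 2" using l by (simp add: trace_2)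
  have yz: "A $ 1 $ 2 * A $ 2 $ 1 = A $ 1 $ 1 * A $ 2 $ 2 - 1" using det by (simp add: det_2)
  \<comment> \<open>These are the columns of A - m I, whose range lies in the eigenspace of
    \<open>l\<close> by Cayley-Hamilton. They cannot both vanish because \<open>l\<close> differs
    from \<open>m\<close>.\<close>
  define v w :: "real^2" where "v = vector [l - A $ 2 $ 2, A $ 2 $ 1]" and "w = vector [A $ 1 $ 2, l - A $ 1 $ 1]"
  have "A *v v = l *\<^sub>R v"
  proof -
    have "A $ 1 $ 1 * (l - A $ 2 $ 2) + A $ 1 $ 2 * A $ 2 $ 1 = l * (l - A $ 2 $ 2)"
      unfolding yz using l(1) by (simp add: x algebra_simps)
    then show ?thesis
      by (simp add: v_def vec_eq_iff forall_2 matrix_vector_mult_def sum_2 algebra_simps)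
  qed
  moreover have "A *v w = l *\<^sub>R w"
  proof -
    have "A $ 2 $ 1 * A $ 1 $ 2 + A $ 2 $ 2 * (l - A $ 1 $ 1) = l * (l - A $ 1 $ 1)"
      unfolding mult.commute[of "A $ 2 $ 1"] yz using l(1) by (simp add: x algebra_simps)
    then show ?thesis
      by (simp add: w_def vec_eq_iff forall_2 matrix_vector_mult_def sum_2 algebra_simps)
  qed
  moreover have "v \<noteq> 0 \<or> w \<noteq> 0"
  proof (rule ccontr)
    assume "\<not> ?thesis"
    then have "v $ 1 = 0" "w $ 2 = 0" by auto
    then have "l = m" using x by (simp add: v_def w_def)
    then have "\<bar>l\<bar> * \<bar>l\<bar> = 1" using l(1) by simp
    then show False using less_1_mult[OF l(3) l(3)] by linarith
  qed
  ultimately show ?thesis using that by blast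
qed

text \<open>Period matrices at neighbouring starting sites are conjugate by a one-step
  matrix.\<close>

lemma trace_transfer_translate:
  assumes "translate (int p) V = V"
  shows "trace (transfer_matrix p E (translate (int j) V)) = trace (transfer_matrix p E V)"
proof (induction j)
  case (Suc j)
  define U where "U = translate (int (Suc j)) V"
  define M where "M = one_step_matrix E (U 0)"
  have U: "(\<lambda>i. U (i + 1)) = apply_bcontfun (translate (int j) V)"
    by (rule ext) (simp add: U_def algebra_simps)
  have "U (int p) = U 0"
    using periodic_apply[OF assms, of "- int (Suc j)" 1] by (simp add: U_def algebra_simps)
  then have "M ** transfer_matrix p E U = transfer_matrix (p + 1) E U"
    by (simp add: transfer_matrix_Suc M_def)
  also have "\<dots> = transfer_matrix p E (translate (int j) V) ** M"
    unfolding transfer_matrix_add by (simp add: transfer_matrix_Suc M_def U)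
  finally have comm: "M ** transfer_matrix p E U = transfer_matrix p E (translate (int j) V) ** M" .
  have "invertible M" by (simp add: invertible_det_nz M_def)
  then obtain N where N: "M ** N = mat 1" "N ** M = mat 1" by (auto simp: invertible_def)
  have "transfer_matrix p E U = N ** (transfer_matrix p E (translate (int j) V) ** M)"
    unfolding comm[symmetric] by (simp add: matrix_mul_assoc N)
  then have "trace (transfer_matrix p E U) = trace (transfer_matrix p E (translate (int j) V) ** M ** N)"
    by (simp only: trace_mul_sym[of N])
  then have "trace (transfer_matrix p E U) = trace (transfer_matrix p E (translate (int j) V))"
    by (simp only: N matrix_mul_assoc[symmetric] matrix_mul_rid)
  then show ?case unfolding U_def by (rule trans[OF _ Suc])
qed simp

text \<open>The last equation cancels the growing term in the trace of n periods followed by an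
  impurity \<open>d\<close>. The strict inequality leaves room for a small change of energy and for
  a bounded loss per block, so \<open>c\<close> can stay the same through all stages.\<close>

definition critical_impurity :: "real \<Rightarrow> potential \<Rightarrow> nat \<Rightarrow> real \<Rightarrow> real \<Rightarrow> bool" where
  "critical_impurity c V p E d \<longleftrightarrow> 0 < p \<and> translate (int p) V = V \<and>
     (let A = transfer_matrix p E V in
       2 < \<bar>trace A\<bar> \<and> A $ 2 $ 1 \<noteq> 0 \<and> c * real p < ln \<bar>dominant (trace A)\<bar> \<and>
       d * A $ 2 $ 1 = eigen_gap (trace A))"

text \<open>An eigenvector of the dominant eigenvalue gives the bound without any additive
  constant.\<close>

lemma log_norm_period_ge:
  assumes per: "translate (int p) W = W" and tr: "2 < \<bar>trace (transfer_matrix p E W)\<bar>"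
  shows "real n * ln \<bar>dominant (trace (transfer_matrix p E W))\<bar> \<le> log_norm (n * p) E W"
proof -
  let ?A = "transfer_matrix p E W"
  let ?l = "dominant (trace ?A)"
  obtain v where v: "v \<noteq> 0" "?A *v v = ?l *\<^sub>R v"
    using eigenvector_exists[OF det_transfer dominant_inverse[OF tr] abs_dominant(2)[OF tr]] by blast
  have "transfer_matrix (n * p) E W *v v = ?l ^ n *\<^sub>R v"
  proof (induction n)
    case (Suc n)
    have "transfer_matrix (Suc n * p) E W = ?A ** transfer_matrix (n * p) E W"
      using transfer_matrix_add[of p "n * p" E W] periodic_shift[OF per, of n] by simp
    then have "transfer_matrix (Suc n * p) E W *v v = ?A *v (transfer_matrix (n * p) E W *v v)"
      by (simp add: matrix_vector_mul_assoc)
    then show ?case by (simp add: Suc v(2) matrix_vector_mult_scaleR mult.commute)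
  qed simp
  then have "\<bar>?l\<bar> ^ n * norm v \<le> op_norm (transfer_matrix (n * p) E W) * norm v"
    using norm_mult_le_op_norm[of "transfer_matrix (n * p) E W" v] by (simp add: power_abs)
  then have "\<bar>?l\<bar> ^ n \<le> op_norm (transfer_matrix (n * p) E W)" using v(1) by simp
  then have "ln (\<bar>?l\<bar> ^ n) \<le> log_norm (n * p) E W"
    unfolding log_norm_def using abs_dominant(2)[OF tr] by (intro ln_mono) auto
  then show ?thesis using abs_dominant(2)[OF tr] by (simp add: ln_realpow)
qed

lemma log_norm_mult_le:
  "log_norm (q * N) E W \<le> (\<Sum>i<q. log_norm N E (translate (- int (i * N)) W))"
proof (induction q)
  case (Suc q)
  have "log_norm (Suc q * N) E W \<le> log_norm N E (translate (- int (q * N)) W) + log_norm (q * N) E W"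
    using log_norm_add[of N "q * N" E W] by simp
  then show ?case using Suc by simp
qed simp

lemma translate_mod_period:
  assumes "translate (int p) V = V"
  shows "translate (i mod int p) V = translate i V"
proof -
  have "translate i V = translate (i mod int p) (translate (int p * (i div int p)) V)"
    by (simp add: add.commute)
  then show ?thesis by (simp only: translate_mult_period[OF assms])
qed

text \<open>A length \<open>N\<close> unrelated to the period is handled by taking \<open>N\<close>
  periods and cutting them into \<open>p\<close> blocks of length \<open>N\<close>. Summed over all
  starting sites, each block contributes the same amount, since shifts permute the residues.\<close>

lemma sum_log_norm_ge:
  assumes crit: "critical_impurity c V p E d"
  shows "c * real N * real p \<le> (\<Sum>j<p. log_norm N E (translate (int j) V))"
proof -
  let ?t = "trace (transfer_matrix p E V)"
  have p: "0 < p" and per: "translate (int p) V = V" and tr: "2 < \<bar>?t\<bar>"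
    and c: "c * real p < ln \<bar>dominant ?t\<bar>"
    using crit by (auto simp: critical_impurity_def Let_def)
  let ?S = "\<Sum>j<p. log_norm N E (translate (int j) V)"
  have low: "real N * (c * real p) \<le> log_norm (p * N) E (translate (int j) V)" for j
  proof -
    have "translate (int p) (translate (int j) V) = translate (int j) (translate (int p) V)"
      by (simp add: add.commute)
    then have per': "translate (int p) (translate (int j) V) = translate (int j) V"
      by (simp only: per)
    have "real N * (c * real p) \<le> real N * ln \<bar>dominant ?t\<bar>"
      using c by (intro mult_left_mono) auto
    also have "\<dots> \<le> log_norm (N * p) E (translate (int j) V)"
      using log_norm_period_ge[OF per', of E N] tr by (simp add: trace_transfer_translate[OF per])
    finally show ?thesis by (simp add: mult.commute)
  qed
  have "real p * (real N * (c * real p)) = (\<Sum>j<p. real N * (c * real p))" by simp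
  also have "\<dots> \<le> (\<Sum>j<p. log_norm (p * N) E (translate (int j) V))"
    by (rule sum_mono) (rule low)
  also have "\<dots> \<le> (\<Sum>j<p. \<Sum>i<p. log_norm N E (translate (- int (i * N)) (translate (int j) V)))"
    by (rule sum_mono) (rule log_norm_mult_le)
  also have "\<dots> = (\<Sum>i<p. \<Sum>j<p. log_norm N E (translate (int j + - int (i * N)) V))"
    by (subst sum.swap) (simp add: add.commute)
  also have "\<dots> = (\<Sum>i<p. ?S)"
  proof (rule sum.cong[OF refl])
    fix i
    have "?S = (\<Sum>j<p. log_norm N E (translate (int (nat ((int j + - int (i * N)) mod int p))) V))"
      by (rule sum.reindex_bij_betw[OF bij_betw_add_mod[OF p], symmetric])
    then show "(\<Sum>j<p. log_norm N E (translate (int j + - int (i * N)) V)) = ?S"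
      using p by (simp only: translate_mod_period[OF per] int_nat_eq) (simp add: translate_mod_period[OF per] del: translate_translate)
  qed
  also have "\<dots> = real p * ?S" by simp
  finally show ?thesis using p by (simp add: mult.commute mult.left_commute)
qed

section \<open>Transfer matrix entries as polynomials in the energy\<close>

fun dirichlet_poly :: "real \<Rightarrow> real \<Rightarrow> (int \<Rightarrow> real) \<Rightarrow> nat \<Rightarrow> real poly" where
  "dirichlet_poly a b W 0 = [:a:]"
| "dirichlet_poly a b W (Suc 0) = [:b:]"
| "dirichlet_poly a b W (Suc (Suc n)) = [:- W (int n), 1:] * dirichlet_poly a b W (Suc n) - dirichlet_poly a b W n"

text \<open>The columns are the two fundamental solutions of the eigenvalue equation. Index 0 of
  \<open>dirichlet_poly\<close> belongs to site -1, so index \<open>n\<close> is the value at site n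
  - 1.\<close>

lemma transfer_matrix_poly:
  "transfer_matrix n E W $ 1 $ 1 = poly (dirichlet_poly 0 1 W (Suc n)) E"
  "transfer_matrix n E W $ 1 $ 2 = poly (dirichlet_poly 1 0 W (Suc n)) E"
  "transfer_matrix n E W $ 2 $ 1 = poly (dirichlet_poly 0 1 W n) E"
  "transfer_matrix n E W $ 2 $ 2 = poly (dirichlet_poly 1 0 W n) E"
proof (induction n)
  case 0
  {
    case 1 show ?case by (simp add: mat_def)
  next
    case 2 show ?case by (simp add: mat_def)
  next
    case 3 show ?case by (simp add: mat_def)
  next
    case 4 show ?case by (simp add: mat_def)
  }
next
  case (Suc n)
  {
    case 1 show ?case by (simp add: transfer_matrix_Suc matrix_mult_2 one_step_matrix_nth Suc algebra_simps)
  next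
    case 2 show ?case by (simp add: transfer_matrix_Suc matrix_mult_2 one_step_matrix_nth Suc algebra_simps)
  next
    case 3 show ?case by (simp add: transfer_matrix_Suc matrix_mult_2 one_step_matrix_nth Suc)
  next
    case 4 show ?case by (simp add: transfer_matrix_Suc matrix_mult_2 one_step_matrix_nth Suc)
  }
qed

lemma dirichlet_poly_monic: "degree (dirichlet_poly 0 1 W (Suc n)) = n \<and> lead_coeff (dirichlet_poly 0 1 W (Suc n)) = 1"
proof (induction n rule: induct_nat_012)
  case 1
  show ?case by simp
next
  case (ge2 n)
  define P Q where "P = dirichlet_poly 0 1 W (Suc (Suc n))" and "Q = dirichlet_poly 0 1 W (Suc n)"
  have P: "degree P = Suc n" "lead_coeff P = 1" and Q: "degree Q = n"
    using ge2 unfolding P_def Q_def by blast+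
  let ?q = "[:- W (int (Suc n)), 1:] * P"
  have "P \<noteq> 0" using P by auto
  then have deg: "degree ?q = Suc (Suc n)" using P by (subst degree_mult_eq) auto
  have lead: "lead_coeff ?q = 1" using P by (subst lead_coeff_mult) simp
  have less: "degree (- Q) < degree ?q" using Q deg by simp
  have eq: "dirichlet_poly 0 1 W (Suc (Suc (Suc n))) = - Q + ?q" unfolding P_def Q_def by simp
  have "degree (- Q + ?q) = Suc (Suc n)" using degree_add_eq_right[OF less] deg by simp
  moreover have "lead_coeff (- Q + ?q) = 1" using lead_coeff_add_le[OF less] lead by simp
  ultimately show ?case unfolding eq by blast
qed simp

lemma degree_dirichlet_poly_other: "degree (dirichlet_poly 1 0 W n) \<le> n - 1"
proof (induction n rule: induct_nat_012)
  case (ge2 n)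
  have "degree ([:- W (int n), 1:] * dirichlet_poly 1 0 W (Suc n)) \<le> degree [:- W (int n), 1:] + degree (dirichlet_poly 1 0 W (Suc n))"
    by (rule degree_mult_le)
  also have "\<dots> \<le> 1 + n" using ge2(2) by simp
  finally have "degree ([:- W (int n), 1:] * dirichlet_poly 1 0 W (Suc n)) \<le> Suc n" by simp
  moreover have "degree (dirichlet_poly 1 0 W n) \<le> Suc n" using ge2(1) by simp
  ultimately show ?case by (simp add: degree_diff_le)
qed simp_all

definition trace_poly :: "(int \<Rightarrow> real) \<Rightarrow> nat \<Rightarrow> real poly" where
  "trace_poly W n = dirichlet_poly 0 1 W (Suc n) + dirichlet_poly 1 0 W n"

lemma poly_trace: "poly (trace_poly W n) E = trace (transfer_matrix n E W)"
  by (simp add: trace_poly_def trace_2 transfer_matrix_poly)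

text \<open>Used twice: the trace exceeds any bound far to the right, and its degree beats that of
  the lower left entry, so that a given strength is critical at finitely many energies only.\<close>

lemma trace_poly_monic:
  assumes "0 < n"
  shows "degree (trace_poly W n) = n" "lead_coeff (trace_poly W n) = 1"
proof -
  have less: "degree (dirichlet_poly 1 0 W n) < degree (dirichlet_poly 0 1 W (Suc n))"
    using degree_dirichlet_poly_other[of W n] dirichlet_poly_monic[of W n] assms by linarith
  show "degree (trace_poly W n) = n"
    unfolding trace_poly_def degree_add_eq_left[OF less] using dirichlet_poly_monic by blast
  have "lead_coeff (dirichlet_poly 0 1 W (Suc n) + dirichlet_poly 1 0 W n) = lead_coeff (dirichlet_poly 0 1 W (Suc n))"
    using lead_coeff_add_le[OF less] by (simp add: add.commute)
  then show "lead_coeff (trace_poly W n) = 1"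
    unfolding trace_poly_def using dirichlet_poly_monic by metis
qed

lemma poly_large:
  fixes q :: "real poly"
  assumes "lead_coeff q > 0"
  obtains x where "b < x" "0 < poly q x"
proof -
  obtain n where n: "\<And>x. x \<ge> n \<Longrightarrow> poly q x \<ge> lead_coeff q" using poly_pinfty_gt_lc[OF assms] by blast
  show ?thesis by (rule that[of "max n (b + 1)"]) (use n[of "max n (b + 1)"] assms in auto)
qed

lemma poly_nonneg_beyond_roots:
  fixes q :: "real poly"
  assumes "lead_coeff q > 0" "\<And>x. b < x \<Longrightarrow> poly q x \<noteq> 0"
  shows "b < x \<Longrightarrow> 0 < poly q x" and "0 \<le> poly q b"
proof -
  have neg: "False" if x: "b \<le> x" "poly q x < 0" for x
  proof -
    obtain y where y: "x < y" "0 < poly q y" using poly_large[OF assms(1)] by blast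
    obtain r where "x < r" "poly q r = 0" using poly_IVT_pos[OF y(1) x(2) y(2)] by blast
    then show False using assms(2) x by simp
  qed
  show "b < x \<Longrightarrow> 0 < poly q x" using neg[of x] assms(2)[of x] by force
  show "0 \<le> poly q b" using neg[of b] by force
qed

text \<open>At the largest Dirichlet eigenvalue the trace is at most \<open>-2\<close>, so the band edge
  \<open>trace = 2\<close> lies strictly above it, where the entry in the denominator of the critical
  strength is positive.\<close>

lemma critical_impurity_near_edge:
  assumes per: "translate (int p) V = V" and p: "2 \<le> p" and e: "0 < e"
  obtains c E d F where "0 < c" "critical_impurity c V p E d" "\<bar>d\<bar> < e"
    "\<bar>trace (transfer_matrix p F V)\<bar> < 2"
proof -
  define X where "X n = dirichlet_poly 0 1 V n" for n
  define S where "S = {x. \<exists>n\<in>{1..p}. poly (X n) x = 0}"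
  have lead: "lead_coeff (X n) > 0" if n: "1 \<le> n" for n
  proof -
    obtain k where "n = Suc k" using n by (cases n) auto
    then have "lead_coeff (X n) = 1" unfolding X_def using dirichlet_poly_monic by blast
    then show ?thesis by (simp only: zero_less_one)
  qed
  have ne: "X n \<noteq> 0" if "1 \<le> n" for n using lead[OF that] by auto
  have "finite S"
  proof -
    have "S = (\<Union>n\<in>{1..p}. {x. poly (X n) x = 0})" by (auto simp: S_def)
    then show ?thesis using ne by (auto intro!: poly_roots_finite)
  qed
  \<comment> \<open>This root makes the maximum over \<open>S\<close> meaningful and is where
    \<open>2 \<le> p\<close> enters.\<close>
  have "poly (X 2) (V 0) = 0" by (simp add: X_def numeral_2_eq_2)
  then have "V 0 \<in> S" using p by (auto simp: S_def intro!: bexI[of _ 2])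
  define b where "b = Max S"
  have "b \<in> S" unfolding b_def using \<open>finite S\<close> \<open>V 0 \<in> S\<close> by (intro Max_in) auto
  have beyond: "poly (X n) x \<noteq> 0" if "n \<in> {1..p}" "b < x" for n x
  proof
    assume "poly (X n) x = 0"
    then have "x \<in> S" using that unfolding S_def by blast
    then have "x \<le> b" unfolding b_def using \<open>finite S\<close> by (rule Max_ge[rotated])
    then show False using that by simp
  qed
  have nonneg: "0 \<le> poly (X n) b" and pos: "b < x \<Longrightarrow> 0 < poly (X n) x" if "n \<in> {1..p}" for n x
    using poly_nonneg_beyond_roots[OF lead beyond[OF that], of b] that by auto
  have consecutive: "poly (X n) x \<noteq> 0 \<or> poly (X (Suc n)) x \<noteq> 0" for n x
    using det_transfer[of n x V] by (auto simp: det_2 transfer_matrix_poly X_def)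
  have rec: "poly (X (Suc (Suc n))) x = (x - V (int n)) * poly (X (Suc n)) x - poly (X n) x" for n x
    by (simp add: X_def algebra_simps)
  obtain n where n: "n \<in> {1..p}" "poly (X n) b = 0" using \<open>b \<in> S\<close> by (auto simp: S_def)
  have "n \<noteq> 1" using n(2) by (auto simp: X_def)
  then obtain m where m: "n = Suc (Suc m)" using n(1) by (cases n; cases "n - 1") auto
  have prev: "0 < poly (X (Suc m)) b"
    using nonneg[of "Suc m"] consecutive[of "Suc m" b] n m by force
  \<comment> \<open>By the recursion, a zero of \<open>X n\<close> at \<open>b\<close> makes the
    following polynomial negative there. Up to index \<open>p\<close> all are nonnegative at
    \<open>b\<close>, so the zero must occur at \<open>n = p\<close>.\<close>
  have next_neg: "poly (X (Suc n)) b < 0"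
    using rec[of "Suc m" b] n(2) prev by (simp add: m)
  have "n = p"
    using nonneg[of "Suc n"] next_neg n(1) by force
  \<comment> \<open>At \<open>b\<close> the matrix is triangular with negative diagonal entries of
    product 1, so its trace is at most -2.\<close>
  define A where "A = transfer_matrix p b V"
  have a: "A $ 2 $ 1 = 0" "A $ 1 $ 1 < 0"
    using n(2) next_neg \<open>n = p\<close> by (auto simp: A_def transfer_matrix_poly X_def)
  then have "A $ 1 $ 1 * A $ 2 $ 2 = 1" using det_transfer[of p b V] by (simp add: det_2 A_def[symmetric])
  then have "A $ 2 $ 2 = 1 / A $ 1 $ 1" using a by (simp add: field_simps)
  then have "trace A + 2 = (A $ 1 $ 1 + 1)\<^sup>2 / A $ 1 $ 1"
    using a by (simp add: trace_2 field_simps power2_eq_square)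
  then have "trace A + 2 \<le> 0" using a by (simp add: divide_nonneg_neg)
  define T where "T = trace_poly V p"
  have Tb: "poly T b \<le> - 2" using \<open>trace A + 2 \<le> 0\<close> by (simp add: T_def poly_trace A_def)
  have monic: "degree T = p" "lead_coeff T = 1" unfolding T_def using p by (intro trace_poly_monic; simp)+
  have "lead_coeff (T - [:3:]) > 0"
  proof -
    have less: "degree (- [:3::real:]) < degree T" using p monic by simp
    have "T - [:3:] = - [:3:] + T" by simp
    then have "lead_coeff (T - [:3:]) = 1"
      using lead_coeff_add_le[OF less] monic(2) by metis
    then show ?thesis by (simp only: zero_less_one)
  qed
  then obtain B where B: "b < B" "0 < poly (T - [:3:]) B" using poly_large by blast
  then have TB: "3 < poly T B" by simp
  obtain F where F: "poly T F = 0" using poly_IVT_pos[of b B T] B Tb TB by auto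
  obtain x0 where x0: "b < x0" "x0 < B" "poly (T - [:2:]) x0 = 0"
    using poly_IVT_pos[of b B "T - [:2:]"] B Tb TB by auto
  \<comment> \<open>A lower bound for the lower left entry on the whole interval is needed before
    \<open>h\<close> is chosen, because the energy \<open>E\<close> depends on
    \<open>h\<close>.\<close>
  have "\<exists>x\<in>{x0..B}. \<forall>y\<in>{x0..B}. poly (X p) x \<le> poly (X p) y"
    using x0 by (intro continuous_attains_inf continuous_intros) auto
  then obtain x1 where x1: "x1 \<in> {x0..B}" "\<And>y. y \<in> {x0..B} \<Longrightarrow> poly (X p) x1 \<le> poly (X p) y" by blast
  define z0 where "z0 = poly (X p) x1"
  have z0: "0 < z0" unfolding z0_def using x1(1) x0 p by (intro pos) auto
  \<comment> \<open>The square of the eigenvalue gap at trace 2 + h is h (4 + h), at most 5 h, hence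
    at most half of \<open>(e * z0)\<^sup>2\<close>. The bound 1 keeps 2 + h below the trace at
    \<open>B\<close>.\<close>
  define h where "h = min 1 ((e * z0)\<^sup>2 / 10)"
  have h: "0 < h" "h \<le> 1" "10 * h \<le> (e * z0)\<^sup>2" using e z0 by (auto simp: h_def)
  obtain E where E: "x0 < E" "E < B" "poly (T - [:2 + h:]) E = 0"
    using poly_IVT_pos[of x0 B "T - [:2 + h:]"] x0 h TB by auto
  define t where "t = 2 + h"
  have t: "trace (transfer_matrix p E V) = t" using E(3) by (simp add: t_def T_def poly_trace)
  have t2: "2 < \<bar>t\<bar>" using h by (simp add: t_def)
  define z where "z = transfer_matrix p E V $ 2 $ 1"
  have z: "z0 \<le> z" using x1(2)[of E] E by (simp add: z_def z0_def transfer_matrix_poly X_def)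
  define d where "d = eigen_gap t / z"
  \<comment> \<open>Half the actual exponent at \<open>E\<close>, to make the inequality
    strict.\<close>
  define c where "c = ln \<bar>dominant t\<bar> / (2 * real p)"
  have ln: "0 < ln \<bar>dominant t\<bar>" using abs_dominant(2)[OF t2] by simp
  have crit: "critical_impurity c V p E d"
    unfolding critical_impurity_def Let_def t z_def[symmetric]
    using p per t2 z z0 ln by (simp add: d_def c_def)
  have "\<bar>d\<bar> < e"
  proof (rule power2_less_imp_less)
    have "(eigen_gap t)\<^sup>2 = h * (4 + h)"
      unfolding eigen_gap_square[OF t2] by (simp add: t_def power2_eq_square algebra_simps)
    also have "\<dots> \<le> h * 5" using h by (intro mult_left_mono) auto
    also have "\<dots> < (e * z0)\<^sup>2" using h by linarith
    also have "\<dots> \<le> (e * z)\<^sup>2" using z z0 e by (intro power_mono mult_left_mono) auto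
    finally have "(eigen_gap t)\<^sup>2 < e\<^sup>2 * z\<^sup>2" by (simp add: power_mult_distrib)
    moreover have "0 < z\<^sup>2" using z z0 by simp
    ultimately show "\<bar>d\<bar>\<^sup>2 < e\<^sup>2" by (simp add: d_def power_divide divide_less_eq)
  qed (use e in simp)
  then show ?thesis
    using that[OF _ crit, of F] ln p F by (simp add: c_def T_def poly_trace)
qed

section \<open>Inserting an impurity\<close>

text \<open>The trace and the lower left entry of \<open>S A\<^sup>n\<close> are \<open>l\<^sup>n + m\<^sup>n - d z u\<^sub>n\<close> and \<open>z u\<^sub>n\<close>
  with \<open>u\<^sub>n = (l\<^sup>n - m\<^sup>n) / (l - m)\<close>, where \<open>A\<close> is the matrix of one period and \<open>S\<close> the shear by
  which an impurity of strength \<open>d\<close> multiplies it from the left.\<close>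

lemma impurity_growth:
  fixes l m s d z e \<gamma> :: real
  assumes lm: "l * m = 1" "1 < \<bar>l\<bar>" and s: "s = l - m" "s \<noteq> 0" "s \<noteq> d * z" and z: "z \<noteq> 0"
    and e: "\<bar>s / z - d\<bar> < e" and \<gamma>: "\<gamma> < ln \<bar>l\<bar>"
  defines "u \<equiv> \<lambda>n. (l ^ n - m ^ n) / s"
  defines "t \<equiv> \<lambda>n. l ^ n + m ^ n - d * (z * u n)"
  shows "\<forall>\<^sub>F n in sequentially. 2 < \<bar>t n\<bar> \<and> z * u n \<noteq> 0 \<and>
    \<gamma> * real n < ln \<bar>dominant (t n)\<bar> \<and> \<bar>eigen_gap (t n) / (z * u n)\<bar> < e"
proof -
  \<comment> \<open>The coefficient of \<open>l ^ n\<close> in \<open>t n\<close>; it is nonzero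
    because \<open>d\<close> is not critical at this energy.\<close>
  define r where "r = 1 - d * z / s"
  have r: "r \<noteq> 0" using s by (simp add: r_def field_simps)
  have l0: "l \<noteq> 0" using lm by auto
  have m: "\<bar>m\<bar> < 1"
  proof -
    have "\<bar>l\<bar> * \<bar>m\<bar> = 1" using lm(1) by (simp flip: abs_mult)
    then have "\<bar>m\<bar> = 1 / \<bar>l\<bar>" using l0 by (simp add: field_simps)
    then show ?thesis using lm(2) by simp
  qed
  have "norm (m / l) < 1"
  proof -
    have "\<bar>m\<bar> < \<bar>l\<bar>" using m lm(2) by linarith
    then show ?thesis using l0 by (simp add: divide_less_eq)
  qed
  then have ml: "(\<lambda>n. (m / l) ^ n) \<longlonglongrightarrow> 0" by (rule LIMSEQ_power_zero)
  have ln: "l ^ n \<noteq> 0" for n using l0 by simp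
  have t_ratio: "t n / l ^ n = r + (1 + d * z / s) * (m / l) ^ n" for n
    using ln[of n] s(2) by (simp add: t_def u_def r_def power_divide field_simps)
  have u_ratio: "z * u n / l ^ n = z / s * (1 - (m / l) ^ n)" for n
    using ln[of n] s(2) by (simp add: u_def power_divide field_simps)
  have t_lim: "(\<lambda>n. t n / l ^ n) \<longlonglongrightarrow> r + (1 + d * z / s) * 0"
    unfolding t_ratio by (intro tendsto_intros ml)
  have u_lim: "(\<lambda>n. z * u n / l ^ n) \<longlonglongrightarrow> z / s * (1 - 0)"
    unfolding u_ratio by (intro tendsto_intros ml)
  have zs: "z / s \<noteq> 0" using z s by simp
  have "(\<lambda>n. \<bar>t n / l ^ n\<bar>) \<longlonglongrightarrow> \<bar>r\<bar>" using tendsto_rabs[OF t_lim] by simp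
  then have ev_t: "\<forall>\<^sub>F n in sequentially. \<bar>r\<bar> / 2 < \<bar>t n / l ^ n\<bar>"
    using r by (intro order_tendstoD) auto
  have "\<forall>\<^sub>F n in sequentially. z * u n / l ^ n \<noteq> 0"
    by (rule tendsto_imp_eventually_ne[OF u_lim]) (use zs in simp)
  \<comment> \<open>As \<open>eigen_gap\<close> is at most the trace in modulus, this quotient
    dominates the new critical strength.\<close>
  moreover have "\<forall>\<^sub>F n in sequentially. \<bar>(t n / l ^ n) / (z * u n / l ^ n)\<bar> < e"
  proof -
    have lim: "(\<lambda>n. \<bar>(t n / l ^ n) / (z * u n / l ^ n)\<bar>) \<longlonglongrightarrow> \<bar>(r + (1 + d * z / s) * 0) / (z / s * (1 - 0))\<bar>"
      using zs by (intro tendsto_rabs tendsto_divide t_lim u_lim) auto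
    have "(r + (1 + d * z / s) * 0) / (z / s * (1 - 0)) = s / z - d"
      using z s by (simp add: r_def field_simps)
    with lim have "(\<lambda>n. \<bar>(t n / l ^ n) / (z * u n / l ^ n)\<bar>) \<longlonglongrightarrow> \<bar>s / z - d\<bar>" by (simp only:)
    then show ?thesis using e by (rule order_tendstoD(2))
  qed
  \<comment> \<open>Together with \<open>ev_t\<close> this pushes \<open>t n\<close> beyond 2 in
    modulus. The condition after it absorbs \<open>ln (\<bar>r\<bar> / 4)\<close>, the loss in
    bounding the dominant eigenvalue below by half the trace.\<close>
  moreover have "\<forall>\<^sub>F n in sequentially. 4 / \<bar>r\<bar> < \<bar>l\<bar> ^ n"
  proof -
    obtain N where N: "4 / \<bar>r\<bar> < \<bar>l\<bar> ^ N" using real_arch_pow[OF lm(2)] by blast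
    have "4 / \<bar>r\<bar> < \<bar>l\<bar> ^ n" if "N \<le> n" for n
      using N power_increasing[OF that, of "\<bar>l\<bar>"] lm(2) by linarith
    then show ?thesis by (auto simp: eventually_sequentially)
  qed
  moreover have "\<forall>\<^sub>F n in sequentially. - ln (\<bar>r\<bar> / 4) < real n * (ln \<bar>l\<bar> - \<gamma>)"
  proof -
    have "filterlim (\<lambda>n. real n * (ln \<bar>l\<bar> - \<gamma>)) at_top sequentially"
      by (rule filterlim_at_top_mult_tendsto_pos[OF tendsto_const _ filterlim_real_sequentially]) (use \<gamma> in simp)
    then show ?thesis by (auto simp: filterlim_at_top_dense)
  qed
  ultimately show ?thesis using ev_t
  proof eventually_elim
    case (elim n)
    have grow: "\<bar>r\<bar> / 2 * \<bar>l\<bar> ^ n < \<bar>t n\<bar>"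
      using elim(5) ln[of n] by (simp add: abs_divide power_abs less_divide_eq)
    have "2 \<le> \<bar>r\<bar> / 2 * \<bar>l\<bar> ^ n" using elim(3) r by (simp add: field_simps)
    then have t2: "2 < \<bar>t n\<bar>" using grow by linarith
    have pos: "0 < \<bar>r\<bar> / 4 * \<bar>l\<bar> ^ n" using r l0 by simp
    have "ln (\<bar>r\<bar> / 4) + real n * ln \<bar>l\<bar> = ln (\<bar>r\<bar> / 4 * \<bar>l\<bar> ^ n)"
    proof -
      have "ln (\<bar>r\<bar> / 4 * \<bar>l\<bar> ^ n) = ln (\<bar>r\<bar> / 4) + ln (\<bar>l\<bar> ^ n)"
        by (rule ln_mult_pos) (use r l0 in auto)
      then show ?thesis using l0 ln_realpow[of "\<bar>l\<bar>" n] by simp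
    qed
    also have "\<dots> \<le> ln \<bar>dominant (t n)\<bar>"
      using pos grow abs_dominant(1)[OF t2] by (intro ln_mono) linarith+
    finally have "\<gamma> * real n < ln \<bar>dominant (t n)\<bar>"
      using elim(4) by (simp add: algebra_simps)
    moreover have "\<bar>eigen_gap (t n) / (z * u n)\<bar> < e"
    proof -
      have "\<bar>eigen_gap (t n) / (z * u n)\<bar> \<le> \<bar>t n\<bar> / \<bar>z * u n\<bar>"
        unfolding abs_divide by (intro divide_right_mono abs_eigen_gap_le t2) simp
      also have "\<dots> = \<bar>(t n / l ^ n) / (z * u n / l ^ n)\<bar>" using ln[of n] by (simp add: abs_divide)
      finally show ?thesis using elim(2) by linarith
    qed
    ultimately show ?case using t2 elim(1) by auto
  qed
qed

lemma transfer_matrix_impurity_power: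
  fixes V :: potential and E d :: real
  assumes per: "translate (int p) V = V" and p: "0 < p" and n: "0 < n"
  defines "A \<equiv> transfer_matrix p E V"
  defines "B \<equiv> transfer_matrix (n * p) E (V + d *\<^sub>R impurity (n * p))"
  assumes t: "2 < \<bar>trace A\<bar>"
  defines "l \<equiv> dominant (trace A)" and "s \<equiv> eigen_gap (trace A)"
  defines "u \<equiv> (l ^ n - (l - s) ^ n) / s"
  shows "trace B = l ^ n + (l - s) ^ n - d * (A $ 2 $ 1 * u)" and "B $ 2 $ 1 = A $ 2 $ 1 * u"
proof -
  obtain k where k: "n = Suc k" using n by (cases n) auto
  have lm: "l * (l - s) = 1" "l + (l - s) = trace A"
    using dominant_inverse[OF t] by (simp_all add: l_def s_def)
  have "cheb (trace A) n * s = l ^ n - (l - s) ^ n"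
    using cheb_eigenvalue(1)[OF lm, of n] by simp
  then have u: "cheb (trace A) n = u"
    using eigen_gap_nonzero[OF t] by (simp add: u_def s_def field_simps)
  define P where "P = transfer_matrix (n * p) E V"
  have P: "P = cheb (trace A) (Suc k) *\<^sub>R A - cheb (trace A) k *\<^sub>R mat 1"
    unfolding P_def k A_def by (rule transfer_matrix_period_power[OF per])
  have "trace P = trace A * cheb (trace A) (Suc k) - 2 * cheb (trace A) k"
    unfolding P by (simp add: trace_2 mat_def algebra_simps)
  also have "\<dots> = l ^ n + (l - s) ^ n"
    unfolding k by (rule cheb_eigenvalue(2)[OF lm])
  finally have tr: "trace P = l ^ n + (l - s) ^ n" .
  have z: "P $ 2 $ 1 = A $ 2 $ 1 * u"
    unfolding P u[symmetric] by (simp add: k mat_def)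
  have "0 < n * p" using n p by simp
  from transfer_matrix_impurity[OF this, of E V d]
  show "trace B = l ^ n + (l - s) ^ n - d * (A $ 2 $ 1 * u)" "B $ 2 $ 1 = A $ 2 $ 1 * u"
    unfolding B_def P_def[symmetric] tr z by simp_all
qed

text \<open>Critical strength means \<open>d z = s\<close>: the impurity then creates a bound state of the
  unperturbed operator at the energy \<open>E\<close>.\<close>

lemma critical_impurity_elliptic:
  assumes "critical_impurity c V p E d" "0 < n"
  shows "\<bar>trace (transfer_matrix (n * p) E (V + d *\<^sub>R impurity (n * p)))\<bar> < 2"
proof -
  define A where "A = transfer_matrix p E V"
  have c: "0 < p" "translate (int p) V = V" "2 < \<bar>trace A\<bar>" "d * A $ 2 $ 1 = eigen_gap (trace A)"
    using assms by (auto simp: critical_impurity_def Let_def A_def)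
  define l s where "l = dominant (trace A)" and "s = eigen_gap (trace A)"
  have s: "s \<noteq> 0" using eigen_gap_nonzero[OF c(3)] by (simp add: s_def)
  have lm: "l * (l - s) = 1" "1 < \<bar>l\<bar>"
    using dominant_inverse[OF c(3)] abs_dominant[OF c(3)] by (simp_all add: l_def s_def)
  have m: "\<bar>l - s\<bar> < 1"
  proof -
    have "\<bar>l\<bar> * \<bar>l - s\<bar> = 1" using lm(1) by (simp flip: abs_mult)
    then have "\<bar>l - s\<bar> = 1 / \<bar>l\<bar>" using lm(2) by (simp add: field_simps)
    then show ?thesis using lm(2) by simp
  qed
  have "trace (transfer_matrix (n * p) E (V + d *\<^sub>R impurity (n * p)))
      = l ^ n + (l - s) ^ n - d * (A $ 2 $ 1 * ((l ^ n - (l - s) ^ n) / s))"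
    using transfer_matrix_impurity_power(1)[OF c(2,1) assms(2), of E d] c(3)
    by (simp add: A_def l_def s_def)
  \<comment> \<open>Criticality cancels \<open>l ^ n\<close>, leaving twice a power of the decaying
    eigenvalue.\<close>
  also have "d * (A $ 2 $ 1 * ((l ^ n - (l - s) ^ n) / s)) = l ^ n - (l - s) ^ n"
    unfolding mult.assoc[symmetric] c(4) s_def[symmetric] using s by simp
  finally have "trace (transfer_matrix (n * p) E (V + d *\<^sub>R impurity (n * p))) = 2 * (l - s) ^ n" by simp
  moreover have "\<bar>l - s\<bar> ^ n < 1" using m assms(2) by (simp add: power_less_one_iff)
  ultimately show ?thesis by (simp add: abs_mult power_abs)
qed

text \<open>The energy \<open>E'\<close> is fixed before \<open>n\<close>: continuity at
  \<open>E\<close> gives all its properties except that \<open>d\<close> must not be critical there,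
  which \<open>q\<close> takes care of. \<open>impurity_growth\<close> then applies to all large
  \<open>n\<close>.\<close>

lemma critical_impurity_step:
  assumes crit: "critical_impurity c V p E d" and e: "0 < e"
  obtains E' where "\<bar>E' - E\<bar> < e"
    "\<forall>\<^sub>F n in sequentially. \<exists>d'. \<bar>d'\<bar> < e \<and>
      critical_impurity c (V + d *\<^sub>R impurity (n * p)) (n * p) E' d'"
proof -
  define A where "A x = transfer_matrix p x V" for x
  have p: "0 < p" and per: "translate (int p) V = V" and t: "2 < \<bar>trace (A E)\<bar>"
    and z: "A E $ 2 $ 1 \<noteq> 0" and c: "c * real p < ln \<bar>dominant (trace (A E))\<bar>"
    and d: "d * A E $ 2 $ 1 = eigen_gap (trace (A E))"
    using crit by (auto simp: critical_impurity_def Let_def A_def)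
  define T Z where "T = trace_poly V p" and "Z = dirichlet_poly 0 1 V p"
  have T: "trace (A x) = poly T x" and Z: "A x $ 2 $ 1 = poly Z x" for x
    by (simp_all add: A_def T_def Z_def poly_trace transfer_matrix_poly)
  have lim_T: "((\<lambda>x. trace (A x)) \<longlongrightarrow> trace (A E)) (at E)"
    unfolding T by (intro tendsto_intros)
  have lim_Z: "((\<lambda>x. A x $ 2 $ 1) \<longlongrightarrow> A E $ 2 $ 1) (at E)"
    unfolding Z by (intro tendsto_intros)
  \<comment> \<open>If \<open>d\<close> is critical at an energy, squaring the equation shows that
    \<open>q\<close> vanishes there. The degrees 2 p and at most 2 p - 2 of the two sides rule out
    \<open>q = 0\<close>.\<close>
  define q where "q = T * T - [:4:] - smult (d\<^sup>2) (Z * Z)"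
  have "q \<noteq> 0"
  proof
    assume "q = 0"
    then have eq: "T * T = [:4:] + smult (d\<^sup>2) (Z * Z)" by (simp add: q_def algebra_simps)
    have T0: "T \<noteq> 0" and degT: "degree T = p" using trace_poly_monic[OF p, of V] p by (auto simp: T_def)
    obtain k where k: "p = Suc k" using p by (cases p) auto
    have degZ: "degree Z = k" unfolding Z_def k using dirichlet_poly_monic by blast
    have "degree (T * T) = p + p" using T0 degT by (simp add: degree_mult_eq)
    moreover have "degree ([:4:] + smult (d\<^sup>2) (Z * Z)) \<le> k + k"
      using degree_mult_le[of Z Z] degZ by (intro degree_add_le order_trans[OF degree_smult_le]) auto
    ultimately show False unfolding eq k by simp
  qed
  then have "\<not> E islimpt {x. poly q x = 0}"
    by (intro islimpt_finite poly_roots_finite)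
  then have ev_q: "\<forall>\<^sub>F x in at E. poly q x \<noteq> 0"
    by (simp add: islimpt_iff_eventually)
  have ev_t: "\<forall>\<^sub>F x in at E. 2 < \<bar>trace (A x)\<bar>"
    by (rule order_tendstoD(1)[OF tendsto_rabs[OF lim_T] t])
  have ev_z: "\<forall>\<^sub>F x in at E. A x $ 2 $ 1 \<noteq> 0"
    by (rule tendsto_imp_eventually_ne[OF lim_Z z])
  have "dominant (trace (A E)) \<noteq> 0" using abs_dominant(2)[OF t] by auto
  then have "((\<lambda>x. ln \<bar>dominant (trace (A x))\<bar>) \<longlongrightarrow> ln \<bar>dominant (trace (A E))\<bar>) (at E)"
    by (intro tendsto_ln tendsto_rabs tendsto_dominant[OF lim_T t]) simp
  then have ev_c: "\<forall>\<^sub>F x in at E. c * real p < ln \<bar>dominant (trace (A x))\<bar>"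
    using c by (rule order_tendstoD(1))
  have "((\<lambda>x. \<bar>eigen_gap (trace (A x)) / A x $ 2 $ 1 - d\<bar>) \<longlongrightarrow> \<bar>eigen_gap (trace (A E)) / A E $ 2 $ 1 - d\<bar>) (at E)"
    by (intro tendsto_intros tendsto_eigen_gap[OF lim_T t] lim_Z z)
  moreover have "\<bar>eigen_gap (trace (A E)) / A E $ 2 $ 1 - d\<bar> < e"
    using z e by (simp flip: d)
  ultimately have ev_d: "\<forall>\<^sub>F x in at E. \<bar>eigen_gap (trace (A x)) / A x $ 2 $ 1 - d\<bar> < e"
    by (rule order_tendstoD(2))
  have ev_e: "\<forall>\<^sub>F x in at E. \<bar>x - E\<bar> < e"
    using e by (auto simp: eventually_at dist_real_def)
  \<comment> \<open>The filter \<open>at E\<close> excludes \<open>E\<close> itself, which is a root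
    of \<open>q\<close>.\<close>
  from eventually_happens[OF eventually_conj[OF ev_q eventually_conj[OF ev_t eventually_conj[OF ev_z
      eventually_conj[OF ev_c eventually_conj[OF ev_d ev_e]]]]]]
  obtain x where x: "poly q x \<noteq> 0" "2 < \<bar>trace (A x)\<bar>" "A x $ 2 $ 1 \<noteq> 0"
    "c * real p < ln \<bar>dominant (trace (A x))\<bar>" "\<bar>eigen_gap (trace (A x)) / A x $ 2 $ 1 - d\<bar> < e" "\<bar>x - E\<bar> < e"
    by auto
  define l s z where "l = dominant (trace (A x))" and "s = eigen_gap (trace (A x))" and "z = A x $ 2 $ 1"
  have s: "s \<noteq> 0" using eigen_gap_nonzero[OF x(2)] by (simp add: s_def)
  have sdz: "s \<noteq> d * z"
  proof
    assume "s = d * z"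
    then have "(trace (A x))\<^sup>2 - 4 = (d * z)\<^sup>2" using eigen_gap_square[OF x(2)] by (simp add: s_def)
    then have "poly q x = 0"
      by (simp add: q_def z_def power_mult_distrib flip: T Z) (simp add: power2_eq_square)
    with x(1) show False by simp
  qed
  define u where "u n = (l ^ n - (l - s) ^ n) / s" for n
  define t where "t n = l ^ n + (l - s) ^ n - d * (z * u n)" for n
  have "\<forall>\<^sub>F n in sequentially. 2 < \<bar>t n\<bar> \<and> z * u n \<noteq> 0 \<and>
      c * real p * real n < ln \<bar>dominant (t n)\<bar> \<and> \<bar>eigen_gap (t n) / (z * u n)\<bar> < e"
    unfolding t_def u_def
  proof (rule impurity_growth)
    show "l * (l - s) = 1" using dominant_inverse[OF x(2)] by (simp add: l_def s_def)
    show "1 < \<bar>l\<bar>" using abs_dominant(2)[OF x(2)] by (simp add: l_def)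
  qed (use x s sdz in \<open>auto simp: l_def s_def z_def\<close>)
  then have "\<forall>\<^sub>F n in sequentially. \<exists>d'. \<bar>d'\<bar> < e \<and>
      critical_impurity c (V + d *\<^sub>R impurity (n * p)) (n * p) x d'"
    using eventually_gt_at_top[of 0]
  proof eventually_elim
    case (elim n)
    define B where "B = transfer_matrix (n * p) x (V + d *\<^sub>R impurity (n * p))"
    have B: "trace B = t n" "B $ 2 $ 1 = z * u n"
      using transfer_matrix_impurity_power[OF per p elim(2), of x d] x(2)
      by (simp_all add: A_def B_def t_def u_def l_def s_def z_def)
    have per': "translate (int (n * p)) (V + d *\<^sub>R impurity (n * p)) = V + d *\<^sub>R impurity (n * p)"
      by (rule translate_add_impurity[OF per]) simp
    have "critical_impurity c (V + d *\<^sub>R impurity (n * p)) (n * p) x (eigen_gap (t n) / (z * u n))"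
      unfolding critical_impurity_def Let_def B_def[symmetric] B
      using p elim per' by (simp add: mult.assoc mult.commute[of "real n"])
    then show ?case using elim(1) by blast
  qed
  then show ?thesis using that x(6) by blast
qed

section \<open>The limit of the impurity construction\<close>

lemma halving_dist:
  fixes x :: "nat \<Rightarrow> 'a::metric_space" and \<eta> :: "nat \<Rightarrow> real"
  assumes step: "\<And>k. dist (x (Suc k)) (x k) \<le> \<eta> k" and half: "\<And>k. \<eta> (Suc k) \<le> \<eta> k / 2"
    and nonneg: "\<And>k. 0 \<le> \<eta> k"
  shows "k \<le> l \<Longrightarrow> dist (x l) (x k) \<le> 2 * \<eta> k" and "Cauchy x"
proof -
  \<comment> \<open>The tail bound \<open>2 * \<eta> l\<close> is added to make the induction
    close.\<close>
  have strong: "dist (x l) (x k) + 2 * \<eta> l \<le> 2 * \<eta> k" if "k \<le> l" for k l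
    using that
  proof (induction l rule: dec_induct)
    case (step l)
    have "dist (x (Suc l)) (x k) \<le> dist (x (Suc l)) (x l) + dist (x l) (x k)"
      by (rule dist_triangle)
    then show ?case using assms(1)[of l] half[of l] step.IH by linarith
  qed simp
  then show le: "dist (x l) (x k) \<le> 2 * \<eta> k" if "k \<le> l" for k l
    using nonneg[of l] that by (smt (verit))
  have geo: "\<eta> k \<le> \<eta> 0 * (1 / 2) ^ k" for k
  proof (induction k)
    case (Suc k)
    then show ?case using half[of k] by simp
  qed simp
  have "(\<lambda>k. 2 * (\<eta> 0 * (1 / 2) ^ k)) \<longlonglongrightarrow> 0"
    by (intro tendsto_mult_right_zero LIMSEQ_power_zero) simp
  show "Cauchy x"
  proof (rule CauchyI')
    fix e :: real assume "0 < e"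
    then obtain K where K: "2 * (\<eta> 0 * (1 / 2) ^ K) < e"
      using order_tendstoD(2)[OF \<open>(\<lambda>k. 2 * (\<eta> 0 * (1 / 2) ^ k)) \<longlonglongrightarrow> 0\<close>]
      by (auto simp: eventually_sequentially)
    have "dist (x m) (x n) < e" if mn: "K \<le> m" "m < n" for m n
    proof -
      have "dist (x n) (x m) \<le> 2 * \<eta> m" using le mn by simp
      also have "2 * \<eta> m \<le> 2 * (\<eta> 0 * (1 / 2) ^ m)" using geo by simp
      also have "\<dots> \<le> 2 * (\<eta> 0 * (1 / 2) ^ K)"
        using nonneg[of 0] mn by (intro mult_left_mono power_decreasing) auto
      finally show ?thesis using K by (simp add: dist_commute)
    qed
    then show "\<exists>M. \<forall>m\<ge>M. \<forall>n>m. dist (x m) (x n) < e" by blast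
  qed
qed

text \<open>A stage \<open>(V, p, E, d, F, C, \<eta>)\<close> consists of a \<open>p\<close>-periodic \<open>V\<close>, an energy \<open>E\<close> with Lyapunov
  exponent above \<open>c\<close> and its critical strength \<open>d\<close>, an elliptic energy \<open>F\<close> with bound \<open>C\<close> on the
  transfer matrices, and a tolerance \<open>\<eta>\<close>. The next stage inserts impurities of strength \<open>d\<close>, so that
  \<open>E\<close> becomes elliptic.\<close>

type_synonym stage = "potential \<times> nat \<times> real \<times> real \<times> real \<times> real \<times> real"

definition valid_stage :: "real \<Rightarrow> stage \<Rightarrow> bool" where
  "valid_stage c = (\<lambda>(V, p, E, d, F, C, \<eta>). 0 < \<eta> \<and> \<bar>d\<bar> < \<eta> \<and> critical_impurity c V p E d \<and>
     (\<forall>m i. op_norm (transfer_matrix m F (\<lambda>x. V (x + i))) \<le> C))"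

text \<open>The constants split \<open>c / 2\<close>, the bound at the elliptic energy, into two
  parts. Later changes total at most 2 \<eta>', costing at most \<open>c / 4\<close> per site; the
  last condition gives the same bound for the new impurities and the constant
  \<open>ln C\<close>.\<close>

definition next_stage :: "real \<Rightarrow> stage \<Rightarrow> stage \<Rightarrow> bool" where
  "next_stage c = (\<lambda>(V, p, E, d, F, C, \<eta>) (V', p', E', d', F', C', \<eta>').
     p dvd p' \<and> V' = V + d *\<^sub>R impurity p' \<and> F' = E \<and> \<bar>E' - E\<bar> < \<eta>' \<and> \<eta>' \<le> \<eta> / 2 \<and>
     \<eta>' \<le> c / (8 * C) \<and> ln C + C * \<bar>d\<bar> \<le> c / 4 * real p')"

text \<open>The order of choices matters: \<open>C\<close> determines \<eta>', this determines
  \<open>E'\<close>, and only then is \<open>n\<close> taken large. The new elliptic energy is the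
  old \<open>E\<close>.\<close>

lemma next_stage_exists:
  assumes c: "0 < c" and valid: "valid_stage c s"
  shows "\<exists>s'. valid_stage c s' \<and> next_stage c s s'"
proof -
  obtain V p E d F C \<eta> where s: "s = (V, p, E, d, F, C, \<eta>)" by (cases s) auto
  have \<eta>: "0 < \<eta>" and crit: "critical_impurity c V p E d"
    and C: "\<And>m i. op_norm (transfer_matrix m F (\<lambda>x. V (x + i))) \<le> C"
    using valid by (auto simp: valid_stage_def s)
  have p: "0 < p" and per: "translate (int p) V = V" using crit by (auto simp: critical_impurity_def)
  have C1: "1 \<le> C" using C[of 0 0] op_norm_transfer_ge_1 order_trans by blast
  define \<eta>' where "\<eta>' = min (\<eta> / 2) (c / (8 * C))"
  have \<eta>': "0 < \<eta>'" using \<eta> c C1 by (simp add: \<eta>'_def)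
  obtain E' where E': "\<bar>E' - E\<bar> < \<eta>'"
    and ev: "\<forall>\<^sub>F n in sequentially. \<exists>d'. \<bar>d'\<bar> < \<eta>' \<and>
      critical_impurity c (V + d *\<^sub>R impurity (n * p)) (n * p) E' d'"
    using critical_impurity_step[OF crit \<eta>'] by blast
  obtain N :: nat where N: "(ln C + C * \<bar>d\<bar>) / (c / 4) < real N" using reals_Archimedean2 by blast
  have large: "ln C + C * \<bar>d\<bar> \<le> c / 4 * real (n * p)" if "N \<le> n" for n
  proof -
    have "n * 1 \<le> n * p" using p by (intro mult_left_mono) auto
    then have "real N \<le> real (n * p)" using that by linarith
    then have "(ln C + C * \<bar>d\<bar>) / (c / 4) \<le> real (n * p)" using N by linarith
    then show ?thesis using c by (simp add: divide_le_eq mult.commute)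
  qed
  obtain n d' where n: "0 < n" "N \<le> n" and d': "\<bar>d'\<bar> < \<eta>'"
    "critical_impurity c (V + d *\<^sub>R impurity (n * p)) (n * p) E' d'"
    using eventually_happens'[OF sequentially_bot eventually_conj[OF ev
        eventually_conj[OF eventually_gt_at_top[of 0] eventually_ge_at_top[of N]]]] by blast
  have per': "translate (int (n * p)) (V + d *\<^sub>R impurity (n * p)) = V + d *\<^sub>R impurity (n * p)"
    and np: "0 < n * p" using d'(2) by (auto simp: critical_impurity_def)
  obtain C' where C': "\<And>m i. op_norm (transfer_matrix m E (\<lambda>x. (V + d *\<^sub>R impurity (n * p)) (x + i))) \<le> C'"
    using elliptic_bounded[OF per' np critical_impurity_elliptic[OF crit n(1)]] by blast
  let ?s' = "(V + d *\<^sub>R impurity (n * p), n * p, E', d', E, C', \<eta>')"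
  have "valid_stage c ?s'"
    unfolding valid_stage_def using \<eta>' d' C' by blast
  moreover have "next_stage c s ?s'"
    unfolding next_stage_def s using E' large[OF n(2)] by (simp add: \<eta>'_def)
  ultimately show ?thesis by blast
qed

lemma sum_impurity:
  assumes "0 < M"
  shows "(\<Sum>x<M. if int M dvd int x + k then d else (0::real)) = d"
proof -
  let ?g = "\<lambda>x. nat ((int x + k) mod int M)"
  have "(\<Sum>x<M. if int M dvd int x + k then d else 0) = (\<Sum>x<M. if ?g x = 0 then d else 0)"
  proof (intro sum.cong refl)
    fix x
    have "0 \<le> (int x + k) mod int M" using assms by simp
    then have "int M dvd int x + k \<longleftrightarrow> ?g x = 0" by (auto simp: dvd_eq_mod_eq_0)
    then show "(if int M dvd int x + k then d else 0) = (if ?g x = 0 then d else 0)" by simp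
  qed
  also have "\<dots> = (\<Sum>y<M. if y = 0 then d else 0)"
    by (rule sum.reindex_bij_betw[OF bij_betw_add_mod[OF assms]])
  also have "\<dots> = d" using assms by simp
  finally show ?thesis .
qed

text \<open>The comparison is with \<open>V\<close> itself, whose transfer matrices at
  \<open>F\<close> are bounded. Any window of length \<open>M\<close> meets exactly one impurity, so
  the summed deviation is at most |d| + h M.\<close>

lemma log_norm_impurity_le:
  fixes V V' :: potential
  assumes C: "\<And>m i. op_norm (transfer_matrix m F (\<lambda>x. V (x + i))) \<le> C" and M: "0 < M"
    and close: "dist V' (V + d *\<^sub>R impurity M) \<le> h"
  shows "log_norm M F (translate j V') \<le> ln C + C * \<bar>d\<bar> + C * h * real M"
proof -
  have C1: "1 \<le> C" using C[of 0 0] op_norm_transfer_ge_1 order_trans by blast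
  have "op_norm (transfer_matrix m F (\<lambda>x. translate j V (x + i))) \<le> C" for m i
    using C[of m "i - j"] by (simp add: add_diff_eq)
  from ln_op_norm_transfer_perturb[OF this, of M "translate j V'"]
  have "log_norm M F (translate j V') \<le> ln C + C * (\<Sum>x<M. \<bar>V' (int x - j) - V (int x - j)\<bar>)"
    by (simp add: log_norm_def)
  also have "(\<Sum>x<M. \<bar>V' (int x - j) - V (int x - j)\<bar>)
      \<le> (\<Sum>x<M. h + (if int M dvd int x + (1 - j) then \<bar>d\<bar> else 0))"
  proof (rule sum_mono)
    fix x
    have "dist (V' (int x - j)) ((V + d *\<^sub>R impurity M) (int x - j)) \<le> h"
      using dist_bounded close by (rule order_trans)
    then have "\<bar>V' (int x - j) - (V (int x - j) + (if int M dvd int x - j + 1 then d else 0))\<bar> \<le> h"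
      by (simp only: dist_real_def apply_add_impurity)
    then show "\<bar>V' (int x - j) - V (int x - j)\<bar> \<le> h + (if int M dvd int x + (1 - j) then \<bar>d\<bar> else 0)"
      by (auto simp: algebra_simps)
  qed
  also have "\<dots> = real M * h + \<bar>d\<bar>"
    by (simp add: sum.distrib sum_impurity[OF M])
  finally show ?thesis using C1 by (simp add: algebra_simps)
qed

lemma discontinuous_near_periodic:
  assumes per: "translate (int p) V0 = V0" and p: "0 < p" and e: "0 < e"
  obtains V where "limit_periodic V" "dist V V0 < e" "\<not> continuous_on UNIV (lyapunov_exponent V)"
proof -
  \<comment> \<open>Doubling the period covers constant potentials, since the band edge argument
    needs a period of at least 2.\<close>
  have per2: "translate (int (p * 2)) V0 = V0" using translate_mult_period[OF per, of 2] by simp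
  have p2: "2 \<le> p * 2" and e4: "0 < e / 4" using p e by simp_all
  obtain c E0 d0 F0 where c: "0 < c" and crit0: "critical_impurity c V0 (p * 2) E0 d0"
    and d0: "\<bar>d0\<bar> < e / 4" and F0: "\<bar>trace (transfer_matrix (p * 2) F0 V0)\<bar> < 2"
    using critical_impurity_near_edge[OF per2 p2 e4] by blast
  obtain C0 where C0: "\<And>m i. op_norm (transfer_matrix m F0 (\<lambda>x. V0 (x + i))) \<le> C0"
    using elliptic_bounded[OF per2 _ F0] p by auto
  let ?s0 = "(V0, p * 2, E0, d0, F0, C0, e / 4)"
  have s0: "valid_stage c ?s0" unfolding valid_stage_def using crit0 d0 C0 e by simp
  \<comment> \<open>The clause for \<open>k = 0\<close> fixes the initial stage in the dependent
    choice.\<close>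
  have "\<exists>s. \<forall>k. (valid_stage c (s k) \<and> (k = 0 \<longrightarrow> s k = ?s0)) \<and> next_stage c (s k) (s (Suc k))"
    by (rule dependent_nat_choice) (use s0 next_stage_exists[OF c] in auto)
  then obtain s where s: "\<And>k. valid_stage c (s k)" "s 0 = ?s0" "\<And>k. next_stage c (s k) (s (Suc k))" by blast
  have "\<exists>V p E d F C \<eta>. s k = (V, p, E, d, F, C, \<eta>)" for k by (cases "s k") auto
  then obtain Vk q E d F C \<eta> where sk: "\<And>k. s k = (Vk k, q k, E k, d k, F k, C k, \<eta> k)" by metis
  have init: "Vk 0 = V0" "\<eta> 0 = e / 4" using s(2) sk[of 0] by auto
  have \<eta>: "0 < \<eta> k" "\<bar>d k\<bar> < \<eta> k" and crit: "critical_impurity c (Vk k) (q k) (E k) (d k)"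
    and C: "op_norm (transfer_matrix m (F k) (\<lambda>x. Vk k (x + i))) \<le> C k" for k m i
    using s(1)[of k] by (auto simp: sk valid_stage_def)
  have dvd: "q k dvd q (Suc k)" and Vk: "Vk (Suc k) = Vk k + d k *\<^sub>R impurity (q (Suc k))"
    and F: "F (Suc k) = E k" and E: "\<bar>E (Suc k) - E k\<bar> < \<eta> (Suc k)"
    and half: "\<eta> (Suc k) \<le> \<eta> k / 2" and \<eta>C: "\<eta> (Suc k) \<le> c / (8 * C k)"
    and lnC: "ln (C k) + C k * \<bar>d k\<bar> \<le> c / 4 * real (q (Suc k))" for k
    using s(3)[of k] by (auto simp: sk next_stage_def)
  have q: "0 < q k" and perk: "translate (int (q k)) (Vk k) = Vk k" for k
    using crit[of k] by (auto simp: critical_impurity_def)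
  have C1: "1 \<le> C k" for k using C[of 0 k 0] op_norm_transfer_ge_1 order_trans by blast
  have stepV: "dist (Vk (Suc k)) (Vk k) \<le> \<eta> k" for k
  proof -
    have "dist (Vk (Suc k)) (Vk k) = norm (d k *\<^sub>R impurity (q (Suc k)))"
      by (simp only: Vk dist_norm add_diff_cancel_left')
    then show ?thesis using norm_impurity_le[of "d k" "q (Suc k)"] \<eta>(2)[of k] by linarith
  qed
  have stepE: "dist (E (Suc k)) (E k) \<le> \<eta> k" for k
    using E[of k] half[of k] \<eta>(1)[of k] by (simp add: dist_real_def)
  note close = halving_dist[of Vk \<eta>, OF stepV half less_imp_le[OF \<eta>(1)]]
  have "Cauchy E" by (rule halving_dist(2)[of E \<eta>, OF stepE half less_imp_le[OF \<eta>(1)]])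
  then obtain x where x: "E \<longlonglongrightarrow> x" using Cauchy_convergent_iff convergent_def by blast
  obtain V where V: "Vk \<longlonglongrightarrow> V" using potential_Cauchy_convergent[OF close(2)] convergent_def by blast
  have closeV: "dist V (Vk k) \<le> 2 * \<eta> k" for k
    by (rule LIMSEQ_le_const2[OF tendsto_dist[OF V tendsto_const]]) (use close(1) in blast)
  interpret limit_periodic_chain V Vk q
    by unfold_locales (use V perk q dvd in auto)
  have lower: "c \<le> lyapunov_exponent V x"
    by (rule lyapunov_ge[OF x]) (rule sum_log_norm_ge[OF crit])
  have upper: "lyapunov_exponent V (F k) \<le> c / 2" for k
  proof (rule lyapunov_le[OF q[of "Suc k"]])
    fix j
    have "log_norm (q (Suc k)) (F k) (translate (int j) V)
        \<le> ln (C k) + C k * \<bar>d k\<bar> + C k * (2 * \<eta> (Suc k)) * real (q (Suc k))"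
      by (rule log_norm_impurity_le[OF C q]) (use closeV[of "Suc k"] in \<open>simp only: Vk\<close>)
    also have "C k * (2 * \<eta> (Suc k)) \<le> c / 4"
      using \<eta>C[of k] C1[of k] by (simp add: field_simps)
    finally show "log_norm (q (Suc k)) (F k) (translate (int j) V) \<le> c / 2 * real (q (Suc k))"
      using lnC[of k] by (simp add: mult_right_mono algebra_simps)
  qed
  have "\<not> continuous_on UNIV (lyapunov_exponent V)"
  proof
    assume "continuous_on UNIV (lyapunov_exponent V)"
    then have "(\<lambda>k. lyapunov_exponent V (E k)) \<longlonglongrightarrow> lyapunov_exponent V x"
      by (rule continuous_on_tendsto_compose[OF _ x]) auto
    \<comment> \<open>\<open>E k\<close> is the elliptic energy of the next stage, so the bound
      \<open>upper\<close> holds along a sequence converging to \<open>x\<close>.\<close>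
    moreover have "lyapunov_exponent V (E k) \<le> c / 2" for k using upper[of "Suc k"] by (simp add: F)
    ultimately have "lyapunov_exponent V x \<le> c / 2" by (intro LIMSEQ_le_const2) auto
    then show False using lower c by simp
  qed
  moreover have "limit_periodic V"
    unfolding limit_periodic_def periodic_def
  proof (intro exI[of _ Vk] conjI allI V)
    fix k
    show "\<exists>p>0. \<forall>n. Vk k (n + p) = Vk k n"
      using periodic_apply[OF perk[of k], of _ 1] q[of k] by (intro exI[of _ "int (q k)"]) simp
  qed
  moreover have "dist V V0 < e" using closeV[of 0] e by (simp add: init)
  ultimately show ?thesis using that by blast
qed

theorem theorem2p2:
  "\<exists>D \<subseteq> {V. limit_periodic V}.
     {V. limit_periodic V} \<subseteq> closure D \<and>
     (\<forall>V\<in>D. \<not> continuous_on UNIV (lyapunov_exponent V))"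
proof (intro exI conjI)
  let ?D = "{V. limit_periodic V \<and> \<not> continuous_on UNIV (lyapunov_exponent V)}"
  show "{V. limit_periodic V} \<subseteq> closure ?D"
  proof clarify
    fix V assume "limit_periodic V"
    then obtain Vk where Vk: "\<And>k. periodic (apply_bcontfun (Vk k))" "Vk \<longlonglongrightarrow> V"
      by (auto simp: limit_periodic_def)
    show "V \<in> closure ?D"
      unfolding closure_approachable
    proof (intro allI impI)
      fix e :: real assume e: "0 < e"
      then obtain k where k: "dist (Vk k) V < e / 2"
        using Vk(2) unfolding lim_sequentially by (meson half_gt_zero order_refl)
      obtain r where r: "0 < r" "\<And>n. Vk k (n + r) = Vk k n" using Vk(1)[of k] by (auto simp: periodic_def)
      have "translate (int (nat r)) (Vk k) = Vk k"
      proof (rule bcontfun_eqI)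
        fix n
        show "translate (int (nat r)) (Vk k) n = Vk k n" using r(1) r(2)[of "n - r"] by simp
      qed
      then obtain W where W: "limit_periodic W" "dist W (Vk k) < e / 2"
        "\<not> continuous_on UNIV (lyapunov_exponent W)"
        using discontinuous_near_periodic[of "nat r" "Vk k" "e / 2"] r(1) e by auto
      have "dist W V < e" using dist_triangle[of W V "Vk k"] W(2) k by linarith
      then show "\<exists>y\<in>?D. dist y V < e" using W by blast
    qed
  qed
qed auto

end
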